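(* Let $m$ and $n$ be non-negative integers such that $m-n+1\ge0$, and let $\Delta(m,n)=(m,m-1,\ldots,m-(n-1))$. Then $$Q_{\Delta(m,n)}(u)=(-1)^{\frac{(m+1)(m+2n)}{2}}\sum_{\mu\in I^{n}_{0}(c_{-m}),\ \mu[0]=\emptyset}\delta_0(\mu)\,S^{odd}_{\mu[1]}(u),$$ where $S^{odd}_\lambda(u)=S_\lambda(u)\big|_{u_{2j}\mapsto0}$ is obtained from the Schur function $S_\lambda(u)$ by setting $u_{2j}=0$ for all $j\ge1$.
   Context: $u=(u_1,u_2,u_3,\ldots)$ are indeterminates; $Q$-functions involve only $u_1,u_3,u_5,\ldots$. Schur functions: $\exp\sum_{n\ge1}u_nz^n=\sum_{n\ge0}h_n(u)z^n$, $h_k=0$ for $k<0$, and $S_\lambda(u)=\det(h_{\lambda_i+j-i}(u))$ for a partition $\lambda$ ($S_\emptyset=1$). Schur $Q$-functions: $\exp\sum_{n\ge1}u_{2n-1}z^{2n-1}=\sum_{n\ge0}q_n(u)z^n$. For $a>b\ge0$, $Q_{a,b}=q_aq_b+2\sum_{i=1}^{b}(-1)^iq_{a+i}q_{b-i}$, and $Q_{a,b}=-Q_{b,a}$ for $a\le b$. For a strict partition written as $\lambda=(\lambda_1>\cdots>\lambda_{2k}\ge0)$ (append one zero if the number of positive parts is odd), $Q_\lambda(u)$ is the Pfaffian of $(Q_{\lambda_i,\lambda_j}(u))_{1\le i,j\le 2k}$; $Q_\emptyset=1$. $Q_\lambda$ depends only on the positive parts of $\lambda$ (in particular a last part $0$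 of $\Delta(m,n)$ is ignored); $\Delta(m,0)=\emptyset$. Colors: a node in column $j$ of (the Young diagram of) a strict partition has color $0$ if $j\equiv0,1\pmod 3$ and color $1$ if $j\equiv2\pmod3$. Set $c_0=\emptyset$, and $c_{-m}=(3m-1,\ldots,5,2)$ for $m>0$. $I^n_0(c_{-m})$ is the set of strict partitions $\mu\supset c_{-m}$ with $|\mu|=|c_{-m}|+n$ such that all nodes of $\mu/c_{-m}$ have color $0$. 3-bar quotient: for a strict partition $\lambda$ and $a=0,1,2$, $\lambda^{(a)}$ is the subpartition of parts congruent to $a$ mod 3. $\lambda[0]$ is the strict partition obtained by dividing the positive parts of $\lambda^{(0)}$ by 3 (zero parts are ignored). Let $\ell_1,\ell_2$ be the numbers of parts of $\lambda^{(1)},\lambda^{(2)}$. Fix an integer $k\ge0$ with $k\ge(\lambda^{(2)}_1+1)/3$ when $\lambda^{(2)}\neq\emptyset$. Let $\mathcal M(k,\lambda)=(a_1,\ldots,a_{\ell_1},b_1,\ldots,b_{k-\ell_2})$, where $a_i=(\lambda^{(1)}_i-1)/3$ and $(b_1,\ldots,b_{k-\ell_2})$ is obtained from $(-1,-2,\ldots,-k)$ by deleting the numbers $-(\lambda^{(2)}_i+1)/3$, $1\le i\le\ell_2$. Then $$\lambda[1]=\mathcal M(k,\lambda)-(\ell_1-\ell_2-1,\ \ell_1-\ell_2-2,\ \ldots,\ \ell_1-\ell_2-(k+\ell_1-\ell_2))$$ (componentwise), a partition which up to trailing zeros is independent of $k$. Signs: write a strict partition as $\lambda=(\lambda_1>\cdots>\lambda_{2k}\ge0)$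 (appending one part $0$ exactly when the number of positive parts is odd; this $0$ then counts as a part of $\lambda^{(0)}$). Put $f(\lambda)=|\lambda^{(2)}|$ (sum of parts), $g(\lambda)=\sum_{i\ge1}\#\{j\mid\lambda^{(1)}_j>\lambda^{(0)}_i\}$, $h(\lambda)=\ell(\lambda^{(2)})$ (number of parts). For $\lambda\in I^n_0(c_{-m})$, $\delta_0(\lambda)=(-1)^{f(\lambda)+g(\lambda)}$ if $m$ is even and $\delta_0(\lambda)=(-1)^{f(\lambda)+g(\lambda)+h(\lambda)}$ if $m$ is odd. *)

theory Defs
  imports
    "HOL-Library.Poly_Mapping"
    "HOL-Combinatorics.Permutations"
    "HOL-Computational_Algebra.Formal_Power_Series"
    "Jordan_Normal_Form.Determinant"
begin

section \<open>Polynomials in the indeterminates \<open>u\<^sub>1, u\<^sub>2, \<dots>\<close>\<close>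

text \<open>
  The inner \<open>nat \<Rightarrow>\<^sub>0 nat\<close> is an exponent vector.  The variable
  of index \<open>0\<close> exists in the type but occurs in none of the polynomials below.
\<close>

type_synonym 'a upoly = "(nat \<Rightarrow>\<^sub>0 nat) \<Rightarrow>\<^sub>0 'a"

definition const :: "'a::zero \<Rightarrow> 'a upoly" where
  "const c = Poly_Mapping.single 0 c"

definition indet :: "nat \<Rightarrow> 'a::zero_neq_one upoly" where
  "indet i = Poly_Mapping.single (Poly_Mapping.single i 1) 1"

definition substitute :: "(nat \<Rightarrow> 'a upoly) \<Rightarrow> 'a::comm_ring_1 upoly \<Rightarrow> 'a upoly" where
  "substitute f p =
     (\<Sum>e\<in>Poly_Mapping.keys p.
        const (Poly_Mapping.lookup p e) *
        (\<Prod>i\<in>Poly_Mapping.keys e. f i ^ Poly_Mapping.lookup e i))"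

text \<open>
  \<open>fps_exp\<close> needs coefficients in a field, so the exponential series is written out
  here; it is meaningful for arguments with constant term \<open>0\<close>.
\<close>

definition exp_fps :: "'a::field_char_0 upoly fps \<Rightarrow> 'a upoly fps" where
  "exp_fps F = fps_compose (Abs_fps (\<lambda>k. const (1 / fact k))) F"


section \<open>Schur functions\<close>

definition h_poly :: "int \<Rightarrow> 'a::field_char_0 upoly" where
  "h_poly k =
     (if k < 0 then 0
      else fps_nth (exp_fps (Abs_fps (\<lambda>n. if n \<ge> 1 then indet n else 0))) (nat k))"

definition schur_S :: "int list \<Rightarrow> 'a::field_char_0 upoly" where
  "schur_S la =
     det (mat (length la) (length la) (\<lambda>(i, j). h_poly (la ! i + int j - int i)))"

definition schur_S_odd :: "int list \<Rightarrow> 'a::field_char_0 upoly" where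
  "schur_S_odd la = substitute (\<lambda>i. if \<exists>j\<ge>1. i = 2 * j then 0 else indet i) (schur_S la)"


section \<open>Schur \<open>Q\<close>-functions\<close>

definition q_poly :: "nat \<Rightarrow> 'a::field_char_0 upoly" where
  "q_poly n = fps_nth (exp_fps (Abs_fps (\<lambda>n. if odd n then indet n else 0))) n"

definition Q_pair_gt :: "nat \<Rightarrow> nat \<Rightarrow> 'a::field_char_0 upoly" where
  "Q_pair_gt a b =
     q_poly a * q_poly b + 2 * (\<Sum>i=1..b. (- 1) ^ i * q_poly (a + i) * q_poly (b - i))"

text \<open>On the diagonal, \<open>Q\<^sub>a\<^sub>,\<^sub>a = - Q\<^sub>a\<^sub>,\<^sub>a\<close> forces the value \<open>0\<close>.\<close>

definition Q_pair :: "nat \<Rightarrow> nat \<Rightarrow> 'a::field_char_0 upoly" where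
  "Q_pair a b =
     (if a > b then Q_pair_gt a b else if a < b then - Q_pair_gt b a else 0)"

text \<open>
  The Pfaffian of a skew-symmetric \<open>2k \<times> 2k\<close> matrix, indexed from \<open>0\<close>, as a sum over the
  perfect matchings of the index set: the two conditions on \<open>p\<close> select exactly one permutation
  for each matching \<open>{p 0, p 1}, {p 2, p 3}, \<dots>\<close>.
\<close>

definition pfaffian :: "nat \<Rightarrow> (nat \<Rightarrow> nat \<Rightarrow> 'r::comm_ring_1) \<Rightarrow> 'r" where
  "pfaffian k A =
     (\<Sum>p | p permutes {..<2 * k} \<and>
            (\<forall>i<k. p (2 * i) < p (2 * i + 1)) \<and>
            (\<forall>i j. i < j \<and> j < k \<longrightarrow> p (2 * i) < p (2 * j)).
        of_int (sign p) * (\<Prod>i<k. A (p (2 * i)) (p (2 * i + 1))))"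

definition even_form :: "nat list \<Rightarrow> nat list" where
  "even_form la =
     (let ps = filter (\<lambda>x. x > 0) la in if odd (length ps) then ps @ [0] else ps)"

definition schur_Q :: "nat list \<Rightarrow> 'a::field_char_0 upoly" where
  "schur_Q la =
     (let xs = even_form la in pfaffian (length xs div 2) (\<lambda>i j. Q_pair (xs ! i) (xs ! j)))"

definition Delta :: "nat \<Rightarrow> nat \<Rightarrow> nat list" where
  "Delta m n = map (\<lambda>i. m - i) [0..<n]"


section \<open>Strict partitions, diagrams and colors\<close>

text \<open>A strict partition is the list of its positive parts in decreasing order.\<close>

definition strict_partition :: "nat list \<Rightarrow> bool" where
  "strict_partition la \<longleftrightarrow> sorted_wrt (>) la \<and> 0 \<notin> set la"

text \<open>Rows are counted from \<open>0\<close>, columns from \<open>1\<close>; the diagram is not shifted.\<close>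

definition diagram :: "nat list \<Rightarrow> (nat \<times> nat) set" where
  "diagram la = {(i, j). i < length la \<and> 1 \<le> j \<and> j \<le> la ! i}"

definition color :: "nat \<times> nat \<Rightarrow> nat" where
  "color = (\<lambda>(i, j). if j mod 3 = 2 then 1 else 0)"

text \<open>\<open>c_neg m\<close> is \<open>c\<^bsub>-m\<^esub>\<close>.\<close>

definition c_neg :: "nat \<Rightarrow> nat list" where
  "c_neg m = map (\<lambda>i. 3 * (m - i) - 1) [0..<m]"

text \<open>\<open>I0 n m\<close> is \<open>I\<^sub>0\<^sup>n(c\<^bsub>-m\<^esub>)\<close>.\<close>

definition I0 :: "nat \<Rightarrow> nat \<Rightarrow> nat list set" where
  "I0 n m = {mu. strict_partition mu \<and>
                 diagram (c_neg m) \<subseteq> diagram mu \<and>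
                 sum_list mu = sum_list (c_neg m) + n \<and>
                 (\<forall>x \<in> diagram mu - diagram (c_neg m). color x = 0)}"

lemma finite_I0: "finite (I0 n m)"
proof -
  let ?N = "sum_list (c_neg m) + n"
  have len: "length xs \<le> sum_list xs" if "0 \<notin> set xs" for xs :: "nat list"
    using that by (induction xs) auto
  have "I0 n m \<subseteq> {xs. set xs \<subseteq> {..?N} \<and> length xs \<le> ?N}"
  proof
    fix xs assume "xs \<in> I0 n m"
    then have "0 \<notin> set xs" and s: "sum_list xs = ?N"
      by (auto simp: I0_def strict_partition_def)
    with len[of xs] show "xs \<in> {xs. set xs \<subseteq> {..?N} \<and> length xs \<le> ?N}"
      using member_le_sum_list[of _ xs] by auto
  qed
  then show ?thesis
    by (rule finite_subset) (rule finite_lists_length_le, simp)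
qed


section \<open>Bar quotient\<close>

definition parts_mod :: "nat \<Rightarrow> nat list \<Rightarrow> nat list" where
  "parts_mod a la = filter (\<lambda>x. x mod 3 = a) la"

definition bar_quotient0 :: "nat list \<Rightarrow> nat list" where
  "bar_quotient0 la = map (\<lambda>x. x div 3) (filter (\<lambda>x. x > 0) (parts_mod 0 la))"

definition admissible :: "nat \<Rightarrow> nat list \<Rightarrow> bool" where
  "admissible k la \<longleftrightarrow> (parts_mod 2 la \<noteq> [] \<longrightarrow> hd (parts_mod 2 la) + 1 \<le> 3 * k)"

text \<open>
  In the two definitions below the divisions are exact.
  The list \<open>bar_quotient1 k la\<close> consists of integers since the sequence it is computed from has
  negative entries; for strict \<open>la\<close> and admissible \<open>k\<close> it is a partition, possibly with trailing
  zeros, whose nonzero parts do not depend on \<open>k\<close>.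
\<close>

definition maya :: "nat \<Rightarrow> nat list \<Rightarrow> int list" where
  "maya k la =
     map (\<lambda>x. (int x - 1) div 3) (parts_mod 1 la) @
     filter (\<lambda>b. b \<notin> (\<lambda>x. - ((int x + 1) div 3)) ` set (parts_mod 2 la))
       (map (\<lambda>i. - int i) [1..<k + 1])"

definition bar_quotient1 :: "nat \<Rightarrow> nat list \<Rightarrow> int list" where
  "bar_quotient1 k la =
     (let d = int (length (parts_mod 1 la)) - int (length (parts_mod 2 la)); M = maya k la
      in map (\<lambda>i. M ! i - (d - 1 - int i)) [0..<length M])"


section \<open>Signs\<close>

definition f_stat :: "nat list \<Rightarrow> nat" where
  "f_stat la = sum_list (parts_mod 2 (even_form la))"

definition g_stat :: "nat list \<Rightarrow> nat" where
  "g_stat la =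
     (\<Sum>x\<leftarrow>parts_mod 0 (even_form la).
        length (filter (\<lambda>y. y > x) (parts_mod 1 (even_form la))))"

definition h_stat :: "nat list \<Rightarrow> nat" where
  "h_stat la = length (parts_mod 2 (even_form la))"

definition delta0 :: "nat \<Rightarrow> nat list \<Rightarrow> int" where
  "delta0 m la =
     (if even m then (- 1) ^ (f_stat la + g_stat la)
      else (- 1) ^ (f_stat la + g_stat la + h_stat la))"

end

theory Submission
  imports Defs
begin

text \<open>
  Setting \<open>u\<^sub>2\<^sub>j = 0\<close> turns \<open>h\<^sub>k\<close> into \<open>q\<^sub>k\<close>, so both sides are expressions in the
  \<open>q\<^sub>k\<close> alone.  Their generating function satisfies \<open>q(z) q(-z) = 1\<close>, because its exponent is odd
  in \<open>z\<close>, and with \<open>q\<^sub>k = 0\<close> for \<open>k < 0\<close> this makes the definition of \<open>Q\<^sub>a\<^sub>,\<^sub>b\<close> visibly skew: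
  \[ Q_{a,b} = \sum_{e \ge 1} (-1)^e (q_{a+e} q_{b-e} - q_{a-e} q_{b+e}) \]
  (lemma \<open>Q_pair_eq_sum\<close>).  In other words, the matrix whose Pfaffian is \<open>Q\<close> of the staircase
  \<open>(m, m - 1, \<dots>)\<close> is \<open>T\<^sup>t B T\<close>, where \<open>T\<close> has the entry \<open>q\<^bsub>m + s - j\<^esub>\<close> in row
  \<open>s \<in> {-m..m}\<close> and column \<open>j\<close>, and where the skew matrix \<open>B\<close> couples only the rows \<open>e\<close> and
  \<open>-e\<close>, with weight \<open>(-1)\<^sup>e\<close>.

  The Pfaffian of a weighted sum of such elementary skew forms is a sum over the sets \<open>A\<close> of half as
  many couples as there are columns: each contributes the product of its weights times the minor of
  \<open>T\<close> on the rows of those couples (lemma \<open>pfaffian_minor_summation\<close>).  For even \<open>n\<close> the row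
  sets are therefore the symmetric sets \<open>A \<union> -A\<close> with \<open>card A = n / 2\<close>.  For odd \<open>n\<close> the Pfaffian
  has one extra column; it is matched by coupling row \<open>0\<close> with one auxiliary row, and the row sets
  become \<open>A \<union> {0} \<union> -A\<close>.

  On the other side, a partition \<open>\<mu>\<close> in the index set without parts divisible by \<open>3\<close> arises from the
  core \<open>(3m - 1, \<dots>, 5, 2)\<close> by lengthening some rows \<open>3j - 1\<close> to \<open>3j + 1\<close>, say those with
  \<open>j \<in> A\<close>, and by adding a part \<open>1\<close> exactly when \<open>n\<close> is odd.  The sequence from which \<open>\<mu>[1]\<close> is
  computed then lists exactly the symmetric set above, so that the Schur function of \<open>\<mu>[1]\<close> is,
  up to reversing the columns, the minor of \<open>T\<close> that belongs to \<open>A\<close>.  A comparison of signs ends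
  the proof.
\<close>


section \<open>Pfaffians as sums over all permutations\<close>


text \<open>
  The condition by which the Pfaffian picks one permutation for every perfect matching.  The
  positions \<open>2 * i\<close> and \<open>2 * i + 1\<close> are regarded as the block \<open>i\<close>.
\<close>

definition in_matching_form :: "nat \<Rightarrow> (nat \<Rightarrow> nat) \<Rightarrow> bool" where
  "in_matching_form k p \<longleftrightarrow>
     (\<forall>i<k. p (2 * i) < p (2 * i + 1)) \<and> (\<forall>i j. i < j \<and> j < k \<longrightarrow> p (2 * i) < p (2 * j))"

definition flip_in_blocks :: "nat set \<Rightarrow> nat \<Rightarrow> nat" where
  "flip_in_blocks F x = (if x div 2 \<in> F then if even x then x + 1 else x - 1 else x)"

definition permute_blocks :: "(nat \<Rightarrow> nat) \<Rightarrow> nat \<Rightarrow> nat" where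
  "permute_blocks \<sigma> x = 2 * \<sigma> (x div 2) + x mod 2"

lemma flip_in_blocks_even [simp]:
  "flip_in_blocks F (2 * i) = (if i \<in> F then 2 * i + 1 else 2 * i)"
  by (simp add: flip_in_blocks_def)

lemma flip_in_blocks_odd [simp]:
  "flip_in_blocks F (Suc (2 * i)) = (if i \<in> F then 2 * i else 2 * i + 1)"
  by (simp add: flip_in_blocks_def)

lemma permute_blocks_even [simp]: "permute_blocks \<sigma> (2 * i) = 2 * \<sigma> i"
  by (simp add: permute_blocks_def)

lemma permute_blocks_odd [simp]: "permute_blocks \<sigma> (Suc (2 * i)) = 2 * \<sigma> i + 1"
  by (simp add: permute_blocks_def)

lemma even_odd_cases: obtains (even) i where "x = 2 * (i::nat)" | (odd) i where "x = Suc (2 * i)"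
  by (metis oddE evenE Suc_eq_plus1)

lemma flip_in_blocks_involution: "flip_in_blocks F (flip_in_blocks F x) = x"
  by (cases x rule: even_odd_cases) auto

lemma permutes_flip_in_blocks:
  assumes "F \<subseteq> {..<k}"
  shows "flip_in_blocks F permutes {..<2 * k}"
proof -
  have "bij (flip_in_blocks F)"
    by (rule involuntory_imp_bij) (rule flip_in_blocks_involution)
  moreover have "flip_in_blocks F x = x" if "x \<notin> {..<2 * k}" for x
    using that assms by (cases x rule: even_odd_cases) auto
  ultimately show ?thesis
    by (simp add: permutes_def bij_iff)
qed

lemma permute_blocks_comp:
  "permute_blocks (\<sigma> \<circ> \<tau>) = permute_blocks \<sigma> \<circ> permute_blocks \<tau>"
proof
  fix x show "permute_blocks (\<sigma> \<circ> \<tau>) x = (permute_blocks \<sigma> \<circ> permute_blocks \<tau>) x"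
    by (cases x rule: even_odd_cases) auto
qed

lemma permutes_permute_blocks:
  assumes "\<sigma> permutes {..<k}"
  shows "permute_blocks \<sigma> permutes {..<2 * k}"
proof -
  have id: "permute_blocks id = id"
    by (auto simp: permute_blocks_def fun_eq_iff)
  have "bij (permute_blocks \<sigma>)"
    using permutes_inv_o[OF assms]
    by (intro o_bij[where g = "permute_blocks (inv_into UNIV \<sigma>)"])
      (simp_all add: permute_blocks_comp[symmetric] id)
  moreover have "permute_blocks \<sigma> x = x" if "x \<notin> {..<2 * k}" for x
    using that permutes_not_in[OF assms] by (cases x rule: even_odd_cases) auto
  ultimately show ?thesis
    by (simp add: permutes_def bij_iff)
qed

text \<open>
  Exchanging two blocks is a product of two transpositions, one for each parity.
\<close>

lemma sign_permute_blocks: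
  assumes "\<sigma> permutes {..<k}"
  shows "sign (permute_blocks \<sigma>) = 1"
  using assms finite_lessThan
proof (induction \<sigma> rule: permutes_induct)
  case id
  have "permute_blocks id = id"
    by (auto simp: permute_blocks_def fun_eq_iff)
  then show ?case by (simp only: sign_id)
next
  case (swap a b p)
  have transp: "permute_blocks (transpose a b) =
      transpose (2 * a) (2 * b) \<circ> transpose (2 * a + 1) (2 * b + 1)"
  proof
    fix x
    show "permute_blocks (transpose a b) x =
        (transpose (2 * a) (2 * b) \<circ> transpose (2 * a + 1) (2 * b + 1)) x"
      by (cases x rule: even_odd_cases) (auto simp: transpose_def; presburger)+
  qed
  have perm: "permutation (permute_blocks p)"
    using permutes_permute_blocks[of p k] swap.hyps permutation_permutes by blast
  show ?case
    using swap perm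
    by (simp only: permute_blocks_comp transp sign_compose permutation_compose permutation_swap_id)
      (simp add: sign_swap_id)
qed

lemma sign_flip_in_blocks:
  assumes "finite F"
  shows "sign (flip_in_blocks F) = (-1) ^ card F"
  using assms
proof (induction F rule: finite_induct)
  case empty
  have "flip_in_blocks {} = id"
    by (auto simp: flip_in_blocks_def fun_eq_iff)
  then show ?case by simp
next
  case (insert a F)
  have eq: "flip_in_blocks (insert a F) = transpose (2 * a) (2 * a + 1) \<circ> flip_in_blocks F"
  proof
    fix x
    show "flip_in_blocks (insert a F) x = (transpose (2 * a) (2 * a + 1) \<circ> flip_in_blocks F) x"
      using insert(2) by (cases x rule: even_odd_cases) (auto simp: transpose_def; presburger)+
  qed
  have "F \<subseteq> {..<Suc (Max F)}"
    using insert(1) by (auto simp: less_Suc_eq_le)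
  then have "permutation (flip_in_blocks F)"
    using permutes_flip_in_blocks permutation_permutes by blast
  then show ?case
    using insert by (simp only: eq sign_compose permutation_swap_id) (simp add: sign_swap_id)
qed

lemma ex1_permutation_sorting:
  fixes \<mu> :: "nat \<Rightarrow> 'b::linorder"
  assumes "inj_on \<mu> {..<k}"
  shows "\<exists>!\<sigma>. \<sigma> permutes {..<k} \<and> strict_mono_on {..<k} (\<mu> \<circ> \<sigma>)"
proof -
  define S where "S = \<mu> ` {..<k}"
  define xs where "xs = sorted_list_of_set S"
  have len: "length xs = k" and set_xs: "set xs = S"
    using assms by (auto simp: xs_def S_def card_image)
  have enum: "map (\<mu> \<circ> \<sigma>) [0..<k] = xs"
    if \<sigma>: "\<sigma> permutes {..<k}" and mono: "strict_mono_on {..<k} (\<mu> \<circ> \<sigma>)" for \<sigma>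
  proof -
    have "sorted_wrt (<) (map (\<mu> \<circ> \<sigma>) [0..<k])"
      using mono by (auto simp: sorted_wrt_iff_nth_less strict_mono_on_def)
    moreover have "set (map (\<mu> \<circ> \<sigma>) [0..<k]) = S"
      using permutes_image[OF \<sigma>] by (metis image_comp list.set_map set_upt atLeast0LessThan S_def)
    ultimately show ?thesis
      unfolding xs_def by (metis sorted_list_of_set_unique[of S] strict_sorted_iff distinct_card
          finite_imageI finite_lessThan S_def)
  qed
  define \<sigma> where "\<sigma> i = (if i < k then inv_into {..<k} \<mu> (xs ! i) else i)" for i
  have nth_S: "xs ! i \<in> \<mu> ` {..<k}" if "i < k" for i
    using that len set_xs nth_mem[of i xs] by (simp add: S_def)
  have \<mu>\<sigma>: "\<mu> (\<sigma> i) = xs ! i" and \<sigma>_less: "\<sigma> i < k" if "i < k" for i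
    using that f_inv_into_f[OF nth_S] inv_into_into[OF nth_S] by (auto simp: \<sigma>_def)
  have mono_xs: "xs ! i < xs ! j" if "i < j" "j < k" for i j
    using that len unfolding xs_def
    by (metis sorted_wrt_nth_less strict_sorted_list_of_set)
  have inj: "inj_on \<sigma> {..<k}"
    using mono_xs \<mu>\<sigma> by (intro linorder_inj_onI') (metis less_irrefl lessThan_iff)
  then have "bij_betw \<sigma> {..<k} {..<k}"
    using \<sigma>_less by (simp add: bij_betw_def endo_inj_surj image_subset_iff)
  then have "\<sigma> permutes {..<k}"
    by (rule bij_imp_permutes) (auto simp: \<sigma>_def)
  moreover have "strict_mono_on {..<k} (\<mu> \<circ> \<sigma>)"
    using mono_xs \<mu>\<sigma> by (auto simp: strict_mono_on_def)
  moreover have "\<tau> = \<sigma>"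
    if \<tau>: "\<tau> permutes {..<k}" "strict_mono_on {..<k} (\<mu> \<circ> \<tau>)" for \<tau>
  proof
    fix i
    show "\<tau> i = \<sigma> i"
    proof (cases "i < k")
      case True
      then have "\<mu> (\<tau> i) = \<mu> (\<sigma> i)"
        using enum[OF \<tau>] \<mu>\<sigma>[OF True] by (metis comp_apply nth_map_upt add_0 diff_zero)
      moreover have "\<tau> i < k"
        using True permutes_in_image[OF \<tau>(1), of i] by simp
      ultimately show ?thesis
        using assms \<sigma>_less[OF True] by (simp add: inj_on_def)
    next
      case False
      then show ?thesis
        using permutes_not_in[OF \<tau>(1)] by (simp add: \<sigma>_def)
    qed
  qed
  ultimately show ?thesis by blast
qed

text \<open>
  Every matching is represented by \<open>2 ^ k * k!\<close> permutations, one for each way to order its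
  pairs and the elements inside the pairs.  To reach the representative in matching form, the
  blocks to be flipped are those in which \<open>p\<close> decreases, and this does not depend on \<open>\<sigma>\<close>; then
  \<open>\<sigma>\<close> must sort the smaller elements of the blocks, which are distinct.
\<close>

lemma ex1_matching_form:
  assumes p: "p permutes {..<2 * k}"
  shows "\<exists>!(F, \<sigma>). F \<subseteq> {..<k} \<and> \<sigma> permutes {..<k} \<and>
    in_matching_form k (p \<circ> flip_in_blocks F \<circ> permute_blocks \<sigma>)"
proof -
  have inj: "p x = p y \<longleftrightarrow> x = y" for x y
    using permutes_inj[OF p] by (simp add: inj_eq)
  define F0 where "F0 = {i. i < k \<and> p (2 * i + 1) < p (2 * i)}"
  define \<mu> where "\<mu> i = p (flip_in_blocks F0 (2 * i))" for i
  have inj_\<mu>: "inj_on \<mu> {..<k}"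
    by (auto simp: inj_on_def \<mu>_def inj split: if_splits)
  have ex1: "\<exists>!\<sigma>. \<sigma> permutes {..<k} \<and> strict_mono_on {..<k} (\<mu> \<circ> \<sigma>)"
    using ex1_permutation_sorting[OF inj_\<mu>] .
  have iff: "in_matching_form k (p \<circ> flip_in_blocks F \<circ> permute_blocks \<sigma>) \<longleftrightarrow>
      F = F0 \<and> strict_mono_on {..<k} (\<mu> \<circ> \<sigma>)"
    if F: "F \<subseteq> {..<k}" and \<sigma>: "\<sigma> permutes {..<k}" for F \<sigma>
  proof -
    have all_\<sigma>: "(\<forall>i<k. P (\<sigma> i)) \<longleftrightarrow> (\<forall>j<k. P j)" for P
    proof -
      have "(\<forall>i\<in>{..<k}. P (\<sigma> i)) \<longleftrightarrow> (\<forall>j\<in>\<sigma> ` {..<k}. P j)" by simp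
      then show ?thesis unfolding permutes_image[OF \<sigma>] by auto
    qed
    have "(\<forall>i<k. p (flip_in_blocks F (2 * \<sigma> i)) < p (flip_in_blocks F (2 * \<sigma> i + 1))) \<longleftrightarrow>
        (\<forall>j<k. p (flip_in_blocks F (2 * j)) < p (flip_in_blocks F (2 * j + 1)))"
      by (rule all_\<sigma>)
    also have "\<dots> \<longleftrightarrow> (\<forall>j<k. j \<in> F \<longleftrightarrow> j \<in> F0)"
    proof -
      have "p (flip_in_blocks F (2 * j)) < p (flip_in_blocks F (2 * j + 1)) \<longleftrightarrow> (j \<in> F \<longleftrightarrow> j \<in> F0)"
        if "j < k" for j
      proof -
        have "p (2 * j) \<noteq> p (Suc (2 * j))" by (simp add: inj)
        then show ?thesis using that by (cases "j \<in> F") (auto simp: F0_def)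
      qed
      then show ?thesis by blast
    qed
    also have "\<dots> \<longleftrightarrow> F = F0"
      using F by (auto simp: F0_def)
    finally show ?thesis
      unfolding in_matching_form_def
      by (auto simp: \<mu>_def strict_mono_on_def simp del: flip_in_blocks_even flip_in_blocks_odd)
  qed
  have F0: "F0 \<subseteq> {..<k}" by (auto simp: F0_def)
  obtain \<tau> where \<tau>: "\<tau> permutes {..<k}" "strict_mono_on {..<k} (\<mu> \<circ> \<tau>)"
    and unique: "\<And>\<sigma>. \<sigma> permutes {..<k} \<and> strict_mono_on {..<k} (\<mu> \<circ> \<sigma>) \<Longrightarrow> \<sigma> = \<tau>"
    using ex1 by (elim ex1E) blast
  show ?thesis
  proof (intro ex1I[of _ "(F0, \<tau>)"]; clarify?)
    show "F0 \<subseteq> {..<k} \<and> \<tau> permutes {..<k} \<and>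
        in_matching_form k (p \<circ> flip_in_blocks F0 \<circ> permute_blocks \<tau>)"
      using F0 \<tau> iff by blast
  next
    fix F \<sigma>
    assume "F \<subseteq> {..<k}" "\<sigma> permutes {..<k}"
      "in_matching_form k (p \<circ> flip_in_blocks F \<circ> permute_blocks \<sigma>)"
    then show "F = F0 \<and> \<sigma> = \<tau>"
      using iff unique by blast
  qed
qed

text \<open>
  A sum over all permutations is easier to expand than one over matchings.  The summand is
  invariant under both kinds of block operations: flipping a block changes the sign of the
  permutation and that of one factor, and permuting blocks is even and permutes the factors.
\<close>

lemma sum_all_permutations_eq_pfaffian:
  fixes A :: "nat \<Rightarrow> nat \<Rightarrow> 'r::comm_ring_1"
  assumes skew: "\<And>i j. A j i = - A i j"
  shows "(\<Sum>p | p permutes {..<2 * k}. of_int (sign p) * (\<Prod>i<k. A (p (2 * i)) (p (2 * i + 1)))) =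
    of_nat (2 ^ k * fact k) * pfaffian k A"
proof -
  define w where "w p = of_int (sign p) * (\<Prod>i<k. A (p (2 * i)) (p (2 * i + 1)))" for p
  let ?P = "{p. p permutes {..<2 * k}}"
  let ?W = "Pow {..<k} \<times> {\<sigma>. \<sigma> permutes {..<k}}"
  let ?g = "\<lambda>(F, \<sigma>). flip_in_blocks F \<circ> permute_blocks \<sigma>"
  have g: "?g x permutes {..<2 * k}" if "x \<in> ?W" for x
    using that by (auto intro!: permutes_compose permutes_flip_in_blocks permutes_permute_blocks)
  have fin: "finite ?P" "finite ?W"
    by (auto simp: finite_permutations)
  have w_blocks: "w (p \<circ> permute_blocks \<sigma>) = w p"
    if "p permutes {..<2 * k}" "\<sigma> permutes {..<k}" for p \<sigma>
  proof -
    have "permutation p" "permutation (permute_blocks \<sigma>)"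
      using that permutes_permute_blocks permutation_permutes by blast+
    then have "sign (p \<circ> permute_blocks \<sigma>) = sign p"
      using that by (simp add: sign_compose sign_permute_blocks)
    moreover have "(\<Prod>i<k. A (p (2 * \<sigma> i)) (p (Suc (2 * \<sigma> i)))) =
        (\<Prod>i<k. A (p (2 * i)) (p (Suc (2 * i))))"
      using prod.permute[OF that(2), of "\<lambda>i. A (p (2 * i)) (p (Suc (2 * i)))"]
      by (simp add: comp_def)
    ultimately show ?thesis by (simp add: w_def)
  qed
  have w_flip: "w (p \<circ> flip_in_blocks F) = w p"
    if "p permutes {..<2 * k}" "F \<subseteq> {..<k}" for p F
  proof -
    have finF: "finite F" using that(2) finite_subset by blast
    have "permutation p" "permutation (flip_in_blocks F)"
      using that permutes_flip_in_blocks permutation_permutes by blast+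
    then have "sign (p \<circ> flip_in_blocks F) = sign p * (-1) ^ card F"
      using finF by (simp add: sign_compose sign_flip_in_blocks)
    moreover have "(\<Prod>i<k. A (p (flip_in_blocks F (2 * i))) (p (flip_in_blocks F (2 * i + 1)))) =
        (\<Prod>i<k. (if i \<in> F then - 1 else 1) * A (p (2 * i)) (p (2 * i + 1)))"
    proof (intro prod.cong refl)
      fix i
      show "A (p (flip_in_blocks F (2 * i))) (p (flip_in_blocks F (2 * i + 1))) =
          (if i \<in> F then - 1 else 1) * A (p (2 * i)) (p (2 * i + 1))"
        by (cases "i \<in> F") (simp_all add: skew[of "p (2 * i)" "p (Suc (2 * i))"])
    qed
    moreover have "(\<Prod>i<k. if i \<in> F then - 1 else 1 :: 'r) = (- 1) ^ card F"
      using that(2) by (simp add: prod.If_cases Int_absorb1)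
    ultimately show ?thesis
      by (simp add: w_def prod.distrib mult.assoc)
  qed
  have w_g: "w (p \<circ> ?g x) = w p" if "p \<in> ?P" "x \<in> ?W" for p x
  proof -
    obtain F \<sigma> where x: "x = (F, \<sigma>)" by force
    have "w (p \<circ> flip_in_blocks F \<circ> permute_blocks \<sigma>) = w (p \<circ> flip_in_blocks F)"
      using that x by (intro w_blocks permutes_compose permutes_flip_in_blocks) auto
    also have "\<dots> = w p"
      using that x by (intro w_flip) auto
    finally show ?thesis by (simp add: x comp_assoc)
  qed
  \<comment> \<open>Each permutation is counted through the unique operation that brings it into matching form.\<close>
  have one: "card {x \<in> ?W. in_matching_form k (p \<circ> ?g x)} = 1" if "p \<in> ?P" for p
  proof -
    have "\<exists>!x. x \<in> ?W \<and> in_matching_form k (p \<circ> ?g x)"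
      using ex1_matching_form[of p k] that by (simp add: case_prod_unfold comp_assoc mem_Times_iff conj_assoc)
    then obtain x where "x \<in> ?W \<and> in_matching_form k (p \<circ> ?g x)"
      and "\<And>y. y \<in> ?W \<and> in_matching_form k (p \<circ> ?g y) \<Longrightarrow> y = x"
      by (elim ex1E) blast
    then have "{x \<in> ?W. in_matching_form k (p \<circ> ?g x)} = {x}" by blast
    then show ?thesis by simp
  qed
  have "(\<Sum>p\<in>?P. w p) = (\<Sum>p\<in>?P. \<Sum>x\<in>{x \<in> ?W. in_matching_form k (p \<circ> ?g x)}. w p)"
    using one by (intro sum.cong) auto
  also have "\<dots> = (\<Sum>p\<in>?P. \<Sum>x\<in>?W. if in_matching_form k (p \<circ> ?g x) then w (p \<circ> ?g x) else 0)"
  proof (rule sum.cong[OF refl])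
    fix p assume p: "p \<in> ?P"
    have "(\<Sum>x\<in>{x \<in> ?W. in_matching_form k (p \<circ> ?g x)}. w p) =
        (\<Sum>x\<in>?W. if in_matching_form k (p \<circ> ?g x) then w p else 0)"
      using fin(2) by (rule sum.inter_filter)
    also have "\<dots> = (\<Sum>x\<in>?W. if in_matching_form k (p \<circ> ?g x) then w (p \<circ> ?g x) else 0)"
      using w_g[OF p] by (intro sum.cong refl) simp
    finally show "(\<Sum>x\<in>{x \<in> ?W. in_matching_form k (p \<circ> ?g x)}. w p) =
        (\<Sum>x\<in>?W. if in_matching_form k (p \<circ> ?g x) then w (p \<circ> ?g x) else 0)" .
  qed
  also have "\<dots> = (\<Sum>x\<in>?W. \<Sum>p\<in>?P. if in_matching_form k (p \<circ> ?g x) then w (p \<circ> ?g x) else 0)"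
    by (rule sum.swap)
  also have "\<dots> = (\<Sum>x\<in>?W. \<Sum>p\<in>?P. if in_matching_form k p then w p else 0)"
  proof (rule sum.cong[OF refl])
    fix x assume "x \<in> ?W"
    then show "(\<Sum>p\<in>?P. if in_matching_form k (p \<circ> ?g x) then w (p \<circ> ?g x) else 0) =
        (\<Sum>p\<in>?P. if in_matching_form k p then w p else 0)"
      by (intro sum_permutations_compose_right[symmetric] g)
  qed
  also have "\<dots> = of_nat (card ?W) * (\<Sum>p\<in>?P. if in_matching_form k p then w p else 0)"
    by simp
  also have "(\<Sum>p\<in>?P. if in_matching_form k p then w p else 0) = pfaffian k A"
    unfolding pfaffian_def w_def in_matching_form_def using fin
    by (subst sum.inter_filter[symmetric]) (auto intro!: sum.cong)
  also have "card ?W = 2 ^ k * fact k"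
    by (simp add: card_cartesian_product card_Pow card_permutations)
  finally show ?thesis by (simp only: w_def)
qed


section \<open>Minor summation\<close>


text \<open>
  A row is a function on all column indices, of which only the first \<open>length rs\<close> count.  Hence a
  list of rows can be permuted, extended and cut without changing the rows themselves.
\<close>

definition det_of_rows :: "(nat \<Rightarrow> 'r::comm_ring_1) list \<Rightarrow> 'r" where
  "det_of_rows rs = det (mat (length rs) (length rs) (\<lambda>(i, j). (rs ! i) j))"

lemma sorted_list_of_image_strict_mono:
  fixes s :: "nat \<Rightarrow> 'b::linorder"
  assumes "strict_mono_on {..<k} s"
  shows "sorted_list_of_set (s ` {..<k}) = map s [0..<k]"
proof -
  have "sorted_wrt (<) (map s [0..<k])"
    using assms by (auto simp: sorted_wrt_iff_nth_less strict_mono_on_def)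
  moreover have "set (map s [0..<k]) = s ` {..<k}" by (simp add: atLeast0LessThan)
  moreover have "length (map s [0..<k]) = card (s ` {..<k})"
    using strict_mono_on_imp_inj_on[OF assms] by (simp add: card_image)
  ultimately show ?thesis
    by (metis finite_imageI finite_lessThan sorted_list_of_set_unique)
qed

lemma prod_lessThan_double:
  fixes f :: "nat \<Rightarrow> 'r::comm_monoid_mult"
  shows "(\<Prod>r<2 * k. f r) = (\<Prod>i<k. f (2 * i) * f (2 * i + 1))"
  by (induction k) (simp_all add: mult.assoc)

lemma det_of_rows_concat_pairs:
  "det_of_rows (concat (map (\<lambda>e. [T1 e, T2 e]) xs)) =
    det (mat (2 * length xs) (2 * length xs) (\<lambda>(r, c). (if even r then T1 else T2) (xs ! (r div 2)) c))"
proof -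
  have len: "length (concat (map (\<lambda>e. [T1 e, T2 e]) xs)) = 2 * length xs"
    by (induction xs) auto
  have nth: "concat (map (\<lambda>e. [T1 e, T2 e]) xs) ! r = (if even r then T1 else T2) (xs ! (r div 2))"
    if "r < 2 * length xs" for r
    using that
  proof (induction xs arbitrary: r)
    case (Cons x xs)
    consider "r = 0" | "r = 1" | r' where "r = Suc (Suc r')"
      by (metis One_nat_def not0_implies_Suc)
    then show ?case
      using Cons by cases auto
  qed simp
  show ?thesis
    unfolding det_of_rows_def len
    by (intro arg_cong[where f = det] eq_matI) (auto simp: nth)
qed

text \<open>
  Expanding the product gives one sum for each set \<open>F\<close> of blocks in which the second term is
  taken.  Composing the permutation with the flips of \<open>F\<close> absorbs the sign and turns each of these
  sums into the Leibniz formula of one and the same determinant.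
\<close>

lemma sum_permutations_antisymmetrized_pairs:
  fixes S1 S2 :: "nat \<Rightarrow> nat \<Rightarrow> 'r::comm_ring_1"
  shows "(\<Sum>p | p permutes {..<2 * k}. of_int (sign p) *
      (\<Prod>i<k. S1 i (p (2 * i)) * S2 i (p (2 * i + 1)) - S2 i (p (2 * i)) * S1 i (p (2 * i + 1)))) =
    2 ^ k * det (mat (2 * k) (2 * k) (\<lambda>(r, c). (if even r then S1 else S2) (r div 2) c))"
    (is "(\<Sum>p\<in>?P. _) = 2 ^ k * det ?M")
proof -
  let ?x = "\<lambda>p i. S1 i (p (2 * i)) * S2 i (p (2 * i + 1))"
  let ?y = "\<lambda>p i. S2 i (p (2 * i)) * S1 i (p (2 * i + 1))"
  have det: "det ?M = (\<Sum>p\<in>?P. of_int (sign p) * (\<Prod>i<k. ?x p i))"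
  proof -
    have "det ?M = (\<Sum>p\<in>?P. of_int (sign p) * (\<Prod>r<2 * k. ?M $$ (r, p r)))"
      by (subst det_def'[of _ "2 * k"]) (simp_all add: atLeast0LessThan)
    also have "\<dots> = (\<Sum>p\<in>?P. of_int (sign p) *
        (\<Prod>r<2 * k. (if even r then S1 else S2) (r div 2) (p r)))"
      by (intro sum.cong refl arg_cong2[where f = times] prod.cong)
        (use permutes_in_image in fastforce)
    finally show ?thesis
      by (simp add: prod_lessThan_double)
  qed
  have flipped: "(\<Sum>p\<in>?P. of_int (sign p) *
      ((- 1) ^ card F * (\<Prod>i\<in>F. ?y p i) * (\<Prod>i\<in>{..<k} - F. ?x p i))) = det ?M"
    if F: "F \<subseteq> {..<k}" for F
  proof -
    have fin: "finite F" using F finite_subset by blast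
    have "(\<Sum>p\<in>?P. of_int (sign p) *
          ((- 1) ^ card F * (\<Prod>i\<in>F. ?y p i) * (\<Prod>i\<in>{..<k} - F. ?x p i))) =
        (\<Sum>p\<in>?P. of_int (sign (p \<circ> flip_in_blocks F)) *
          ((- 1) ^ card F * (\<Prod>i\<in>F. ?y (p \<circ> flip_in_blocks F) i) *
            (\<Prod>i\<in>{..<k} - F. ?x (p \<circ> flip_in_blocks F) i)))"
      by (rule sum_permutations_compose_right[OF permutes_flip_in_blocks[OF F]])
    also have "\<dots> = (\<Sum>p\<in>?P. of_int (sign p) * (\<Prod>i<k. ?x p i))"
    proof (intro sum.cong refl)
      fix p assume "p \<in> ?P"
      then have perm: "permutation p" "permutation (flip_in_blocks F)"
        using F permutes_flip_in_blocks permutation_permutes by blast+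
      have "(\<Prod>i\<in>F. ?y (p \<circ> flip_in_blocks F) i) = (\<Prod>i\<in>F. ?x p i)"
        by (intro prod.cong) (simp_all add: mult.commute[of "S2 _ _"])
      moreover have "(\<Prod>i\<in>{..<k} - F. ?x (p \<circ> flip_in_blocks F) i) = (\<Prod>i\<in>{..<k} - F. ?x p i)"
        by (intro prod.cong) simp_all
      moreover have "(\<Prod>i<k. ?x p i) = (\<Prod>i\<in>{..<k} - F. ?x p i) * (\<Prod>i\<in>F. ?x p i)"
        using F by (intro prod.subset_diff) auto
      ultimately show "of_int (sign (p \<circ> flip_in_blocks F)) *
          ((- 1) ^ card F * (\<Prod>i\<in>F. ?y (p \<circ> flip_in_blocks F) i) *
            (\<Prod>i\<in>{..<k} - F. ?x (p \<circ> flip_in_blocks F) i)) =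
          of_int (sign p) * (\<Prod>i<k. ?x p i)"
        using sign_compose[OF perm] sign_flip_in_blocks[OF fin]
        by (simp only: of_int_mult of_int_power of_int_minus of_int_1)
          (simp add: ac_simps)
    qed
    finally show ?thesis by (simp add: det)
  qed
  have "(\<Sum>p\<in>?P. of_int (sign p) * (\<Prod>i<k. ?x p i - ?y p i)) =
      (\<Sum>p\<in>?P. \<Sum>F\<in>Pow {..<k}. of_int (sign p) *
        ((- 1) ^ card F * (\<Prod>i\<in>F. ?y p i) * (\<Prod>i\<in>{..<k} - F. ?x p i)))"
    by (simp only: prod_diff_conv_sum[OF finite_lessThan] sum_distrib_left)
  also have "\<dots> = (\<Sum>F\<in>Pow {..<k}. \<Sum>p\<in>?P. of_int (sign p) *
        ((- 1) ^ card F * (\<Prod>i\<in>F. ?y p i) * (\<Prod>i\<in>{..<k} - F. ?x p i)))"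
    by (rule sum.swap)
  also have "\<dots> = (\<Sum>F\<in>Pow {..<k}. det ?M)"
    by (intro sum.cong refl flipped) auto
  also have "\<dots> = 2 ^ k * det ?M"
    by (simp add: card_Pow)
  finally show ?thesis .
qed

lemma card_extensional_injections_onto:
  assumes "finite A" "card A = k" "A \<subseteq> E"
  shows "card {s \<in> {..<k} \<rightarrow>\<^sub>E E. inj_on s {..<k} \<and> s ` {..<k} = A} = fact k"
proof -
  have "{s \<in> {..<k} \<rightarrow>\<^sub>E E. inj_on s {..<k} \<and> s ` {..<k} = A} =
      {s \<in> {..<k} \<rightarrow>\<^sub>E A. inj_on s {..<k}}"
  proof (intro equalityI subsetI)
    fix s assume "s \<in> {s \<in> {..<k} \<rightarrow>\<^sub>E A. inj_on s {..<k}}"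
    then have s: "s \<in> {..<k} \<rightarrow>\<^sub>E A" "inj_on s {..<k}" by auto
    then have "s ` {..<k} = A"
      using assms(1,2) by (intro card_subset_eq) (auto simp: card_image)
    then show "s \<in> {s \<in> {..<k} \<rightarrow>\<^sub>E E. inj_on s {..<k} \<and> s ` {..<k} = A}"
      using s assms(3) by (auto simp: PiE_iff)
  qed (auto simp: PiE_iff)
  then show ?thesis
    using card_inj_on_subset_funcset[of "{..<k}" A "{..<k}"] assms(1,2) by (simp add: fact_prod_rev)
qed

text \<open>
  The minor summation formula for \<open>T\<^sup>t B T\<close> with a skew matrix \<open>B\<close> that couples row \<open>T1 e\<close> only to
  row \<open>T2 e\<close>.  By \<open>sum_all_permutations_eq_pfaffian\<close> and
  \<open>sum_permutations_antisymmetrized_pairs\<close>, \<open>2 ^ k * k!\<close> times the Pfaffian is \<open>2 ^ k\<close> times a sum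
  over all maps \<open>s\<close> from the blocks to \<open>E\<close>.  A map that is not injective repeats a row and
  contributes \<open>0\<close>; the \<open>k!\<close> injective maps with a given image \<open>A\<close> contribute the same, since
  permuting blocks of rows is even.  Both factors cancel, which is where characteristic \<open>0\<close> and the
  absence of zero divisors are used.
\<close>

lemma pfaffian_minor_summation:
  fixes T1 T2 :: "nat \<Rightarrow> nat \<Rightarrow> 'r::{idom,ring_char_0}"
  assumes fin: "finite E"
  shows "pfaffian k (\<lambda>i j. \<Sum>e\<in>E. w e * (T1 e i * T2 e j - T2 e i * T1 e j)) =
    (\<Sum>A | A \<subseteq> E \<and> card A = k.
       (\<Prod>e\<in>A. w e) * det_of_rows (concat (map (\<lambda>e. [T1 e, T2 e]) (sorted_list_of_set A))))"
proof -
  let ?C = "\<lambda>i j. \<Sum>e\<in>E. w e * (T1 e i * T2 e j - T2 e i * T1 e j)"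
  let ?P = "{p. p permutes {..<2 * k}}"
  let ?R = "{..<k} \<rightarrow>\<^sub>E E"
  define D where "D s = det (mat (2 * k) (2 * k) (\<lambda>(r, c). (if even r then T1 else T2) (s (r div 2)) c))"
    for s :: "nat \<Rightarrow> nat"
  define V where "V A = (\<Prod>e\<in>A. w e) * D (\<lambda>i. sorted_list_of_set A ! i)" for A
  have finR: "finite ?R" using fin by (intro finite_PiE) auto
  have D_not_inj: "D s = 0" if ninj: "\<not> inj_on s {..<k}" for s
  proof -
    obtain a b where ab: "a < k" "b < k" "a \<noteq> b" "s a = s b"
      using ninj by (auto simp: inj_on_def)
    show ?thesis
      unfolding D_def using ab
      by (intro det_identical_rows[of _ "2 * k" "2 * a" "2 * b"]) (auto intro!: eq_vecI)
  qed
  have D_permute: "D (s \<circ> \<sigma>) = D s" if \<sigma>: "\<sigma> permutes {..<k}" for s \<sigma>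
  proof -
    let ?M = "mat (2 * k) (2 * k) (\<lambda>(r, c). (if even r then T1 else T2) (s (r div 2)) c)"
    have less: "permute_blocks \<sigma> r < 2 * k" if "r < 2 * k" for r
      using that permutes_in_image[OF permutes_permute_blocks[OF \<sigma>], of r] by simp
    have "D (s \<circ> \<sigma>) = det (mat (2 * k) (2 * k) (\<lambda>(r, c). ?M $$ (permute_blocks \<sigma> r, c)))"
      unfolding D_def using less
      by (intro arg_cong[where f = det] eq_matI) (auto simp: permute_blocks_def)
    also have "\<dots> = of_int (sign (permute_blocks \<sigma>)) * det ?M"
      using permutes_permute_blocks[OF \<sigma>] by (intro det_permute_rows) (auto simp: atLeast0LessThan)
    finally show ?thesis
      using sign_permute_blocks[OF \<sigma>] by (simp add: D_def)
  qed
  have D_inj: "(\<Prod>i<k. w (s i)) * D s = V A" if "inj_on s {..<k}" "s ` {..<k} = A" for s A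
  proof -
    obtain \<sigma> where \<sigma>: "\<sigma> permutes {..<k}" "strict_mono_on {..<k} (s \<circ> \<sigma>)"
      using ex1_permutation_sorting[OF \<open>inj_on s {..<k}\<close>] by blast
    have "(s \<circ> \<sigma>) ` {..<k} = A"
      using that(2) permutes_image[OF \<sigma>(1)] by (metis image_comp)
    then have "sorted_list_of_set A = map (s \<circ> \<sigma>) [0..<k]"
      using sorted_list_of_image_strict_mono[OF \<sigma>(2)] by simp
    then have "D (\<lambda>i. sorted_list_of_set A ! i) = D (s \<circ> \<sigma>)"
      unfolding D_def by (intro arg_cong[where f = det] eq_matI) auto
    moreover have "(\<Prod>i<k. w (s i)) = (\<Prod>e\<in>A. w e)"
      using that by (metis (mono_tags, lifting) prod.reindex_cong)
    ultimately show ?thesis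
      using D_permute[OF \<sigma>(1)] by (simp add: V_def)
  qed
  have "of_nat (2 ^ k * fact k) * pfaffian k ?C =
      (\<Sum>p\<in>?P. of_int (sign p) * (\<Prod>i<k. ?C (p (2 * i)) (p (2 * i + 1))))"
  proof (rule sum_all_permutations_eq_pfaffian[symmetric])
    show "?C j i = - ?C i j" for i j
      by (simp add: sum_negf[symmetric] algebra_simps)
  qed
  also have "\<dots> = (\<Sum>p\<in>?P. \<Sum>s\<in>?R. (\<Prod>i<k. w (s i)) * (of_int (sign p) *
      (\<Prod>i<k. T1 (s i) (p (2 * i)) * T2 (s i) (p (2 * i + 1)) -
             T2 (s i) (p (2 * i)) * T1 (s i) (p (2 * i + 1)))))"
    using fin by (subst prod_sum_PiE) (auto simp: prod.distrib sum_distrib_left ac_simps)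
  also have "\<dots> = (\<Sum>s\<in>?R. (\<Prod>i<k. w (s i)) * (\<Sum>p\<in>?P. of_int (sign p) *
      (\<Prod>i<k. T1 (s i) (p (2 * i)) * T2 (s i) (p (2 * i + 1)) -
             T2 (s i) (p (2 * i)) * T1 (s i) (p (2 * i + 1)))))"
    by (subst sum.swap) (simp only: sum_distrib_left)
  also have "\<dots> = (\<Sum>s\<in>?R. (\<Prod>i<k. w (s i)) * (2 ^ k * D s))"
  proof (intro sum.cong refl arg_cong2[where f = times])
    fix s
    show "(\<Sum>p\<in>?P. of_int (sign p) *
      (\<Prod>i<k. T1 (s i) (p (2 * i)) * T2 (s i) (p (2 * i + 1)) -
             T2 (s i) (p (2 * i)) * T1 (s i) (p (2 * i + 1)))) = 2 ^ k * D s"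
      unfolding D_def sum_permutations_antisymmetrized_pairs[where ?S1.0 = "\<lambda>i. T1 (s i)" and ?S2.0 = "\<lambda>i. T2 (s i)"]
      by (intro arg_cong2[where f = times] arg_cong[where f = det] eq_matI) auto
  qed
  also have "\<dots> = 2 ^ k * (\<Sum>s\<in>?R. (\<Prod>i<k. w (s i)) * D s)"
    by (simp add: sum_distrib_left ac_simps)
  also have "(\<Sum>s\<in>?R. (\<Prod>i<k. w (s i)) * D s) =
      (\<Sum>s\<in>{s \<in> ?R. inj_on s {..<k}}. (\<Prod>i<k. w (s i)) * D s)"
    using finR D_not_inj by (intro sum.mono_neutral_right) auto
  also have "\<dots> = (\<Sum>A\<in>{A. A \<subseteq> E \<and> card A = k}.
      \<Sum>s\<in>{s \<in> {s \<in> ?R. inj_on s {..<k}}. s ` {..<k} = A}. (\<Prod>i<k. w (s i)) * D s)"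
  proof (rule sum.group[symmetric])
    show "finite {s \<in> ?R. inj_on s {..<k}}" using finR by simp
    show "finite {A. A \<subseteq> E \<and> card A = k}" using fin by simp
    show "(\<lambda>s. s ` {..<k}) ` {s \<in> ?R. inj_on s {..<k}} \<subseteq> {A. A \<subseteq> E \<and> card A = k}"
      by (auto simp: card_image)
  qed
  also have "\<dots> = (\<Sum>A\<in>{A. A \<subseteq> E \<and> card A = k}. fact k * V A)"
  proof (intro sum.cong refl)
    fix A assume A: "A \<in> {A. A \<subseteq> E \<and> card A = k}"
    then have "finite A" using fin finite_subset by blast
    have "(\<Sum>s\<in>{s \<in> {s \<in> ?R. inj_on s {..<k}}. s ` {..<k} = A}. (\<Prod>i<k. w (s i)) * D s) =
        (\<Sum>s\<in>{s \<in> ?R. inj_on s {..<k} \<and> s ` {..<k} = A}. V A)"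
      using D_inj by (intro sum.cong) auto
    then show "(\<Sum>s\<in>{s \<in> {s \<in> ?R. inj_on s {..<k}}. s ` {..<k} = A}. (\<Prod>i<k. w (s i)) * D s) =
        fact k * V A"
      using card_extensional_injections_onto[of A k E] A \<open>finite A\<close> by simp
  qed
  finally have "of_nat (2 ^ k * fact k) * pfaffian k ?C =
      of_nat (2 ^ k * fact k) * (\<Sum>A | A \<subseteq> E \<and> card A = k. V A)"
    by (simp add: sum_distrib_left mult.assoc)
  then have "pfaffian k ?C = (\<Sum>A | A \<subseteq> E \<and> card A = k. V A)"
    by (subst (asm) mult_cancel_left) (simp del: of_nat_mult of_nat_power of_nat_fact)
  also have "\<dots> = (\<Sum>A | A \<subseteq> E \<and> card A = k.
       (\<Prod>e\<in>A. w e) * det_of_rows (concat (map (\<lambda>e. [T1 e, T2 e]) (sorted_list_of_set A))))"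
    by (intro sum.cong refl) (auto simp: V_def D_def det_of_rows_concat_pairs)
  finally show ?thesis .
qed


section \<open>Rearranging rows and columns\<close>


lemma det_of_rows_swap:
  "det_of_rows (xs @ a # b # ys) = - det_of_rows (xs @ b # a # ys)"
proof -
  let ?n = "length xs + Suc (Suc (length ys))"
  let ?\<tau> = "transpose (length xs) (Suc (length xs))"
  let ?M = "mat ?n ?n (\<lambda>(i, j). ((xs @ b # a # ys) ! i) j)"
  have \<tau>: "?\<tau> permutes {0..<?n}"
    by (rule permutes_swap_id) auto
  have nth: "(xs @ a # b # ys) ! i = (xs @ b # a # ys) ! ?\<tau> i" for i
  proof -
    consider "i < length xs" | "i = length xs" | "i = Suc (length xs)" | "i > Suc (length xs)"
      by linarith
    then show ?thesis
      by cases (auto simp: nth_append transpose_def nth_Cons' )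
  qed
  have "det_of_rows (xs @ a # b # ys) = det (mat ?n ?n (\<lambda>(i, j). ?M $$ (?\<tau> i, j)))"
    unfolding det_of_rows_def using permutes_in_image[OF \<tau>]
    by (intro arg_cong[where f = det] eq_matI) (simp_all add: nth)
  also have "\<dots> = of_int (sign ?\<tau>) * det ?M"
    using \<tau> by (intro det_permute_rows) auto
  finally show ?thesis
    by (simp add: det_of_rows_def sign_swap_id)
qed

lemma det_of_rows_move:
  "det_of_rows (xs @ a # ys @ zs) = (- 1) ^ length ys * det_of_rows (xs @ ys @ a # zs)"
proof (induction ys arbitrary: xs)
  case (Cons b ys)
  have "det_of_rows (xs @ a # (b # ys) @ zs) = - det_of_rows ((xs @ [b]) @ a # ys @ zs)"
    by (simp add: det_of_rows_swap[of xs a b])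
  also have "\<dots> = (- 1) ^ length (b # ys) * det_of_rows (xs @ (b # ys) @ a # zs)"
    by (subst Cons.IH) simp
  finally show ?case .
qed simp

text \<open>
  A pair passes any list of rows with an even number of transpositions.
\<close>

lemma det_of_rows_move_pair:
  "det_of_rows (xs @ a # b # ys @ zs) = det_of_rows (xs @ ys @ a # b # zs)"
proof -
  have "det_of_rows (xs @ a # b # ys @ zs) = (- 1) ^ length ys * det_of_rows (xs @ a # ys @ b # zs)"
    using det_of_rows_move[of "xs @ [a]" b ys zs] by simp
  also have "\<dots> = (- 1) ^ length ys * ((- 1) ^ length ys * det_of_rows (xs @ ys @ a # b # zs))"
    by (subst det_of_rows_move) simp
  finally show ?thesis by simp
qed

text \<open>
  For increasing \<open>es\<close>, with \<open>T1 e\<close> as row \<open>e\<close> and \<open>T2 e\<close> as row \<open>-e\<close>, the interleaved rows of the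
  minor summation formula are brought into decreasing order at no cost in sign: the first pair moves past the reversed list of the
  remaining \<open>T1\<close>-rows.
\<close>

lemma det_of_rows_unzip_pairs:
  "det_of_rows (xs @ concat (map (\<lambda>e. [T1 e, T2 e]) es) @ ys) =
    det_of_rows (xs @ rev (map T1 es) @ map T2 es @ ys)"
proof (induction es arbitrary: xs)
  case (Cons e es)
  have "det_of_rows (xs @ concat (map (\<lambda>e. [T1 e, T2 e]) (e # es)) @ ys) =
      det_of_rows ((xs @ [T1 e, T2 e]) @ rev (map T1 es) @ map T2 es @ ys)"
    by (subst Cons.IH[symmetric]) simp
  also have "\<dots> = det_of_rows (xs @ rev (map T1 es) @ T1 e # T2 e # map T2 es @ ys)"
    using det_of_rows_move_pair[of xs "T1 e" "T2 e" "rev (map T1 es)"] by simp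
  finally show ?case by simp
qed simp

lemma det_of_rows_rev:
  "det_of_rows (xs @ rev ys) = (- 1) ^ (length ys choose 2) * det_of_rows (xs @ ys)"
proof (induction ys arbitrary: xs)
  case (Cons y ys)
  have "(- 1) ^ length ys * det_of_rows (xs @ rev (y # ys)) = det_of_rows ((xs @ [y]) @ rev ys)"
    using det_of_rows_move[of xs y "rev ys" "[]"] by simp
  also have "\<dots> = (- 1) ^ (length ys choose 2) * det_of_rows (xs @ y # ys)"
    by (subst Cons.IH) simp
  finally have "(- 1) ^ length ys * ((- 1) ^ length ys * det_of_rows (xs @ rev (y # ys))) =
      (- 1) ^ length ys * ((- 1) ^ (length ys choose 2) * det_of_rows (xs @ y # ys))"
    by simp
  then show ?case
    by (simp add: numeral_2_eq_2 power_add mult.assoc)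
qed (simp add: numeral_2_eq_2)

lemma det_reverse_columns:
  "det (mat n n (\<lambda>(i, j). f i (n - 1 - j))) =
    (- 1) ^ (n choose 2) * det (mat n n (\<lambda>(i, j). f i j :: 'r::comm_ring_1))"
proof -
  let ?cs = "map (\<lambda>j i. f i j) [0..<n]"
  have "det (mat n n (\<lambda>(i, j). f i (n - 1 - j))) = det (transpose_mat (mat n n (\<lambda>(i, j). f i (n - 1 - j))))"
    by (rule det_transpose[symmetric]) auto
  also have "\<dots> = det_of_rows (rev ?cs)"
    unfolding det_of_rows_def by (intro arg_cong[where f = det] eq_matI) (auto simp: rev_nth)
  also have "\<dots> = (- 1) ^ (n choose 2) * det_of_rows ?cs"
    using det_of_rows_rev[of "[]" ?cs] by simp
  also have "det_of_rows ?cs = det (transpose_mat (mat n n (\<lambda>(i, j). f i j)))"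
    unfolding det_of_rows_def by (intro arg_cong[where f = det] eq_matI) auto
  also have "\<dots> = det (mat n n (\<lambda>(i, j). f i j))"
    by (rule det_transpose) auto
  finally show ?thesis .
qed

lemma det_last_row_unit:
  assumes "\<And>j. j < n \<Longrightarrow> f n j = 0" "f n n = 1"
  shows "det (mat (Suc n) (Suc n) (\<lambda>(i, j). f i j)) = det (mat n n (\<lambda>(i, j). f i j :: 'r::comm_ring_1))"
proof -
  let ?M = "mat (Suc n) (Suc n) (\<lambda>(i, j). f i j)"
  have "det ?M = (\<Sum>j<Suc n. ?M $$ (n, j) * cofactor ?M n j)"
    by (rule laplace_expansion_row) auto
  also have "\<dots> = cofactor ?M n n"
    using assms by simp
  also have "\<dots> = det (mat_delete ?M n n)"
    by (simp add: cofactor_def flip: mult_2)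
  also have "mat_delete ?M n n = mat n n (\<lambda>(i, j). f i j)"
    by (intro eq_matI) (auto simp: mat_delete_def)
  finally show ?thesis .
qed

lemma det_of_rows_snoc:
  assumes "\<And>x. x \<in> set rs \<Longrightarrow> x (length rs) = 0" "r (length rs) = 1"
  shows "det_of_rows (rs @ [r]) = det_of_rows rs"
proof -
  let ?n = "length rs"
  have "det_of_rows (rs @ [r]) = det (transpose_mat (mat (Suc ?n) (Suc ?n) (\<lambda>(i, j). ((rs @ [r]) ! i) j)))"
    unfolding det_of_rows_def by (subst det_transpose) auto
  also have "\<dots> = det (mat (Suc ?n) (Suc ?n) (\<lambda>(i, j). ((rs @ [r]) ! j) i))"
    by (intro arg_cong[where f = det] eq_matI) auto
  also have "\<dots> = det (mat ?n ?n (\<lambda>(i, j). ((rs @ [r]) ! j) i))"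
    using assms by (intro det_last_row_unit) (auto simp: nth_append)
  also have "\<dots> = det (transpose_mat (mat ?n ?n (\<lambda>(i, j). (rs ! i) j)))"
    by (intro arg_cong[where f = det] eq_matI) (auto simp: nth_append)
  also have "\<dots> = det_of_rows rs"
    unfolding det_of_rows_def by (subst det_transpose) auto
  finally show ?thesis .
qed

lemma pfaffian_cong:
  assumes "\<And>i j. i < 2 * k \<Longrightarrow> j < 2 * k \<Longrightarrow> A i j = B i j"
  shows "pfaffian k A = pfaffian k B"
proof -
  have "A (p (2 * i)) (p (2 * i + 1)) = B (p (2 * i)) (p (2 * i + 1))"
    if "p permutes {..<2 * k}" "i < k" for p i
    using that permutes_in_image[OF that(1), of "2 * i"] permutes_in_image[OF that(1), of "2 * i + 1"]
    by (intro assms) auto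
  then show ?thesis
    unfolding pfaffian_def by (intro sum.cong refl arg_cong2[where f = times] prod.cong) auto
qed

text \<open>
  By the zero column, a matching contributes only if it pairs \<open>2 * k\<close> with the larger index
  \<open>2 * k + 1\<close>.  In matching form such a pair comes last, so that the remaining blocks are a
  matching of the first \<open>2 * k\<close> indices.
\<close>

lemma pfaffian_last_pair:
  fixes A :: "nat \<Rightarrow> nat \<Rightarrow> 'r::comm_ring_1"
  assumes unit: "A (2 * k) (2 * k + 1) = 1"
    and zero: "\<And>i. i < 2 * k \<Longrightarrow> A i (2 * k) = 0"
  shows "pfaffian (Suc k) A = pfaffian k A"
proof -
  let ?F = "\<lambda>k. {p. p permutes {..<2 * k} \<and> in_matching_form k p}"
  let ?t = "\<lambda>k p. of_int (sign p) * (\<Prod>i<k. A (p (2 * i)) (p (2 * i + 1)))"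
  have pf: "pfaffian k A = (\<Sum>p\<in>?F k. ?t k p)" for k
    by (simp add: pfaffian_def in_matching_form_def)
  have fin: "finite (?F (Suc k))"
    by (rule finite_subset[OF _ finite_permutations[of "{..<2 * Suc k}"]]) auto
  have sub: "?F k \<subseteq> ?F (Suc k)"
  proof
    fix p assume "p \<in> ?F k"
    then have p: "p permutes {..<2 * k}" "in_matching_form k p" by auto
    have fixed: "p (2 * k) = 2 * k" "p (2 * k + 1) = 2 * k + 1"
      using permutes_not_in[OF p(1)] by auto
    have "p (2 * i) < 2 * k" if "i < k" for i
      using permutes_in_image[OF p(1), of "2 * i"] that by simp
    then have "in_matching_form (Suc k) p"
      using p(2) fixed by (auto simp: in_matching_form_def less_Suc_eq)
    moreover have "p permutes {..<2 * Suc k}"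
      using p(1) by (rule permutes_subset) auto
    ultimately show "p \<in> ?F (Suc k)" by simp
  qed
  have vanish: "?t (Suc k) p = 0" if "p \<in> ?F (Suc k) - ?F k" for p
  proof -
    have p: "p permutes {..<2 * Suc k}" "in_matching_form (Suc k) p" and not: "p \<notin> ?F k"
      using that by auto
    have less: "p x < 2 * k + 2" if "x < 2 * k + 2" for x
      using permutes_in_image[OF p(1), of x] that by simp
    \<comment> \<open>The block of \<open>2 * k\<close> decides whether the product vanishes.\<close>
    obtain x where x: "x < 2 * k + 2" "p x = 2 * k"
      using permutes_image[OF p(1)] by (metis (no_types, lifting) add_2_eq_Suc' imageE lessI lessThan_iff
          less_SucI mult_Suc_right add.commute)
    obtain b where b: "b < Suc k" "x = 2 * b \<or> x = 2 * b + 1"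
      using x(1) by (intro that[of "x div 2"]) auto
    have pb: "p (2 * b) < p (2 * b + 1)"
      using p(2) b(1) by (simp add: in_matching_form_def)
    show ?thesis
    proof (cases "x = 2 * b")
      case False
      then have "A (p (2 * b)) (p (2 * b + 1)) = 0"
        using b x pb zero[of "p (2 * b)"] by auto
      then have "(\<Prod>i<Suc k. A (p (2 * i)) (p (2 * i + 1))) = 0"
        using b(1) by (intro prod_zero) auto
      then show ?thesis by simp
    next
      case True
      then have pb1: "p (2 * b) = 2 * k" "p (2 * b + 1) = 2 * k + 1"
        using x pb less[of "2 * b + 1"] b(1) by auto
      have "b = k"
      proof (rule ccontr)
        assume "b \<noteq> k"
        then have "b < k" using b(1) by simp
        then have "p (2 * b) < p (2 * k)" "p (2 * k) < p (2 * k + 1)"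
          using p(2) by (auto simp: in_matching_form_def)
        then show False
          using pb1 less[of "2 * k + 1"] by simp
      qed
      have "p y = y" if "y \<notin> {..<2 * k}" for y
      proof (cases "y < 2 * k + 2")
        case True
        then have "y = 2 * k \<or> y = 2 * k + 1" using that by auto
        then show ?thesis using pb1 \<open>b = k\<close> by auto
      next
        case False
        then show ?thesis using permutes_not_in[OF p(1)] by simp
      qed
      then have "p permutes {..<2 * k}"
        by (intro permutes_superset[OF p(1)]) auto
      moreover have "in_matching_form k p"
        using p(2) by (simp add: in_matching_form_def)
      ultimately show ?thesis using not by simp
    qed
  qed
  have "pfaffian (Suc k) A = (\<Sum>p\<in>?F k. ?t (Suc k) p)"
    unfolding pf using fin sub vanish by (intro sum.mono_neutral_right) auto
  also have "\<dots> = (\<Sum>p\<in>?F k. ?t k p)"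
  proof (rule sum.cong[OF refl])
    fix p assume "p \<in> ?F k"
    then have "p (2 * k) = 2 * k" "p (2 * k + 1) = 2 * k + 1"
      by (auto simp: permutes_not_in)
    then show "?t (Suc k) p = ?t k p"
      using unit by simp
  qed
  finally show ?thesis by (simp only: pf)
qed


section \<open>Substitution and the series of the \<open>q\<^sub>k\<close>\<close>


lemma const_zero [simp]: "const 0 = 0"
  by (simp add: const_def)

lemma const_add: "const (a + b) = const a + const b"
  by (simp add: const_def single_add)

lemma const_mult: "const (a * b) = const a * const b"
  by (simp add: const_def mult_single)

lemma const_of_nat: "const (of_nat n :: 'a::comm_ring_1) = of_nat n"
  by (simp add: const_def)

definition subst_monomial :: "(nat \<Rightarrow> 'a::comm_ring_1 upoly) \<Rightarrow> (nat \<Rightarrow>\<^sub>0 nat) \<Rightarrow> 'a upoly" where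
  "subst_monomial f e = (\<Prod>i\<in>Poly_Mapping.keys e. f i ^ Poly_Mapping.lookup e i)"

lemma subst_monomial_superset:
  assumes "finite S" "Poly_Mapping.keys e \<subseteq> S"
  shows "subst_monomial f e = (\<Prod>i\<in>S. f i ^ Poly_Mapping.lookup e i)"
  unfolding subst_monomial_def using assms
  by (intro prod.mono_neutral_left) (auto simp: in_keys_iff)

lemma subst_monomial_zero [simp]: "subst_monomial f 0 = 1"
  by (simp add: subst_monomial_def)

lemma subst_monomial_add: "subst_monomial f (e + e') = subst_monomial f e * subst_monomial f e'"
proof -
  let ?S = "Poly_Mapping.keys e \<union> Poly_Mapping.keys e'"
  have "subst_monomial f (e + e') = (\<Prod>i\<in>?S. f i ^ Poly_Mapping.lookup (e + e') i)"
    by (intro subst_monomial_superset) (auto simp: in_keys_iff lookup_add)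
  also have "\<dots> = subst_monomial f e * subst_monomial f e'"
    by (simp add: subst_monomial_superset[of ?S] lookup_add power_add prod.distrib)
  finally show ?thesis .
qed

lemma substitute_superset:
  assumes "finite S" "Poly_Mapping.keys p \<subseteq> S"
  shows "substitute f p = (\<Sum>e\<in>S. const (Poly_Mapping.lookup p e) * subst_monomial f e)"
  unfolding substitute_def subst_monomial_def using assms
  by (intro sum.mono_neutral_left) (auto simp: in_keys_iff)

lemma substitute_add: "substitute f (p + q) = substitute f p + substitute f q"
proof -
  let ?S = "Poly_Mapping.keys p \<union> Poly_Mapping.keys q"
  have "substitute f (p + q) = (\<Sum>e\<in>?S. const (Poly_Mapping.lookup (p + q) e) * subst_monomial f e)"
    using keys_add[of p q] by (intro substitute_superset) auto
  also have "\<dots> = substitute f p + substitute f q"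
    by (simp add: substitute_superset[of ?S] lookup_add const_add distrib_right sum.distrib)
  finally show ?thesis .
qed

lemma substitute_zero [simp]: "substitute f 0 = 0"
  by (simp add: substitute_def)

lemma substitute_sum: "substitute f (\<Sum>x\<in>A. g x) = (\<Sum>x\<in>A. substitute f (g x))"
  by (induction A rule: infinite_finite_induct) (simp_all add: substitute_add)

lemma substitute_single: "substitute f (Poly_Mapping.single e c) = const c * subst_monomial f e"
  by (subst substitute_superset[of "{e}"]) auto

text \<open>
  Together with additivity, this makes substitution a ring homomorphism, so that it commutes with
  determinants and with the coefficients of the exponential series.
\<close>

lemma substitute_mult: "substitute f (p * q) = substitute f p * substitute f q"
proof -
  have expand: "p = (\<Sum>e\<in>Poly_Mapping.keys p. Poly_Mapping.single e (Poly_Mapping.lookup p e))"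
    for p :: "'a upoly"
    by (rule poly_mapping_eqI) (simp add: lookup_sum lookup_single when_def in_keys_iff)
  have "p * q = (\<Sum>e\<in>Poly_Mapping.keys p. \<Sum>e'\<in>Poly_Mapping.keys q.
      Poly_Mapping.single (e + e') (Poly_Mapping.lookup p e * Poly_Mapping.lookup q e'))"
    by (subst expand[of p], subst expand[of q]) (simp add: sum_product mult_single)
  also have "substitute f \<dots> = (\<Sum>e\<in>Poly_Mapping.keys p. \<Sum>e'\<in>Poly_Mapping.keys q.
      (const (Poly_Mapping.lookup p e) * subst_monomial f e) *
      (const (Poly_Mapping.lookup q e') * subst_monomial f e'))"
    by (simp add: substitute_sum substitute_single const_mult subst_monomial_add ac_simps)
  also have "\<dots> = substitute f p * substitute f q"
    by (simp add: substitute_def subst_monomial_def sum_product)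
  finally show ?thesis .
qed

lemma substitute_const: "substitute f (const c) = const c"
  by (simp add: const_def substitute_single)

lemma substitute_indet: "substitute f (indet i) = f i"
  by (simp add: indet_def substitute_single subst_monomial_def const_def)

lemma comm_ring_hom_substitute: "comm_ring_hom (substitute f)"
proof
  show "substitute f 1 = 1"
    using substitute_const[of f 1] by (simp add: const_def)
qed (simp_all add: substitute_add substitute_mult)

lemma exp_fps_nth: "fps_nth (exp_fps F) n = (\<Sum>i=0..n. const (1 / fact i) * fps_nth (F ^ i) n)"
  by (simp add: exp_fps_def fps_compose_nth)

lemma substitute_exp_fps:
  "substitute f (fps_nth (exp_fps F) n) = fps_nth (exp_fps (Abs_fps (\<lambda>n. substitute f (fps_nth F n)))) n"
proof -
  interpret comm_ring_hom "substitute f" by (rule comm_ring_hom_substitute)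
  have "substitute f (fps_nth (F ^ i) n) = fps_nth (Abs_fps (\<lambda>n. substitute f (fps_nth F n)) ^ i) n" for i n
  proof (induction i arbitrary: n)
    case (Suc i)
    then show ?case by (simp add: fps_mult_nth hom_sum hom_mult)
  qed simp
  then show ?thesis
    by (simp add: exp_fps_nth hom_sum hom_mult substitute_const)
qed

text \<open>
  The \<open>q\<^sub>k\<close> extended by \<open>0\<close> to negative indices, which makes the summation range of
  \<open>Q\<^sub>a\<^sub>,\<^sub>b\<close> uniform and matches the convention \<open>h\<^sub>k = 0\<close> for \<open>k < 0\<close>.
\<close>

definition q_int :: "int \<Rightarrow> 'a::field_char_0 upoly" where
  "q_int k = (if k < 0 then 0 else q_poly (nat k))"

lemma q_int_of_nat [simp]: "q_int (int n) = q_poly n"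
  by (simp add: q_int_def)

lemma q_int_neg [simp]: "k < 0 \<Longrightarrow> q_int k = 0"
  by (simp add: q_int_def)

lemma q_poly_0 [simp]: "q_poly 0 = 1"
  by (simp add: q_poly_def exp_fps_nth const_def)

lemma q_int_0 [simp]: "q_int 0 = 1"
  by (simp add: q_int_def)

lemma substitute_odd_h_poly:
  "substitute (\<lambda>i. if \<exists>j\<ge>1. i = 2 * j then 0 else indet i) (h_poly k) = (q_int k :: 'a::field_char_0 upoly)"
proof -
  let ?f = "\<lambda>i. if \<exists>j\<ge>1. i = 2 * j then 0 else indet i :: 'a upoly"
  have "Abs_fps (\<lambda>n. substitute ?f (fps_nth (Abs_fps (\<lambda>n. if n \<ge> 1 then indet n else 0)) n)) =
      Abs_fps (\<lambda>n. if odd n then indet n else 0)"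
  proof (rule fps_ext)
    fix n :: nat
    have "(\<exists>j\<ge>1. n = 2 * j) \<longleftrightarrow> even n" if "n \<ge> 1"
      using that by (auto elim!: evenE intro!: exI[of _ "n div 2"])
    moreover have "odd n \<Longrightarrow> n \<ge> 1"
      by (cases n) auto
    ultimately show "fps_nth (Abs_fps (\<lambda>n. substitute ?f (fps_nth (Abs_fps (\<lambda>n. if n \<ge> 1 then indet n else 0)) n))) n =
        fps_nth (Abs_fps (\<lambda>n. if odd n then indet n else 0)) n"
      by (cases "n \<ge> 1") (auto simp: substitute_indet)
  qed
  then show ?thesis
    by (simp add: h_poly_def q_int_def q_poly_def substitute_exp_fps)
qed

lemma schur_S_odd_eq_det:
  "schur_S_odd la =
    (det (mat (length la) (length la) (\<lambda>(i, j). q_int (la ! i + int j - int i))) :: 'a::field_char_0 upoly)"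
proof -
  let ?f = "\<lambda>i. if \<exists>j\<ge>1. i = 2 * j then 0 else indet i :: 'a upoly"
  interpret comm_ring_hom "substitute ?f" by (rule comm_ring_hom_substitute)
  show ?thesis
    unfolding schur_S_odd_def schur_S_def hom_det[symmetric]
    by (intro arg_cong[where f = det] eq_matI) (simp_all add: substitute_odd_h_poly[simplified])
qed

lemma fps_deriv_exp_fps:
  fixes F :: "'a::field_char_0 upoly fps"
  assumes "fps_nth F 0 = 0"
  shows "fps_deriv (exp_fps F) = exp_fps F * fps_deriv F"
proof -
  have "fps_deriv (Abs_fps (\<lambda>k. const (1 / fact k))) = Abs_fps (\<lambda>k. const (1 / fact k) :: 'a upoly)"
  proof (rule fps_ext)
    fix n
    have "of_nat (Suc n) * const (1 / fact (Suc n)) = (const (of_nat (Suc n) * (1 / fact (Suc n))) :: 'a upoly)"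
      by (simp only: const_mult const_of_nat)
    also have "of_nat (Suc n) * (1 / fact (Suc n)) = (1 / fact n :: 'a)"
      by (simp add: field_simps del: of_nat_Suc)
    finally show "fps_nth (fps_deriv (Abs_fps (\<lambda>k. const (1 / fact k)))) n =
        fps_nth (Abs_fps (\<lambda>k. const (1 / fact k) :: 'a upoly)) n"
      by simp
  qed
  then show ?thesis
    unfolding exp_fps_def using assms by (simp add: fps_compose_deriv)
qed

text \<open>
  The coefficients of \<open>q(-z) q(z) = 1\<close>.  Since the exponent \<open>F\<close> of \<open>q(z)\<close> is odd, \<open>F'\<close> is even;
  hence \<open>q(-z)\<close> has the logarithmic derivative \<open>- F'\<close> and the product has derivative \<open>0\<close>.
\<close>

lemma sum_alternating_q_poly:
  assumes "n > 0"
  shows "(\<Sum>i=0..n. (- 1) ^ i * q_poly i * q_poly (n - i) :: 'a::field_char_0 upoly) = 0"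
proof -
  define F :: "'a upoly fps" where "F = Abs_fps (\<lambda>n. if odd n then indet n else 0)"
  define G where "G = exp_fps F"
  define H where "H = Abs_fps (\<lambda>n. (- 1) ^ n * fps_nth G n)"
  have q: "q_poly n = fps_nth G n" for n
    by (simp add: q_poly_def G_def F_def)
  have dG: "fps_deriv G = G * fps_deriv F"
    unfolding G_def by (rule fps_deriv_exp_fps) (simp add: F_def)
  have dF: "(- 1) ^ n * fps_nth (fps_deriv F) n = fps_nth (fps_deriv F) n" for n
    by (simp add: F_def)
  have dH: "fps_deriv H = - (H * fps_deriv F)"
  proof (rule fps_ext)
    fix n
    have "fps_nth (fps_deriv H) n = - ((- 1) ^ n * fps_nth (fps_deriv G) n)"
      by (simp add: H_def algebra_simps)
    also have "(- 1) ^ n * fps_nth (fps_deriv G) n =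
        (\<Sum>i=0..n. (- 1) ^ n * (fps_nth G i * fps_nth (fps_deriv F) (n - i)))"
      unfolding dG fps_mult_nth by (simp only: sum_distrib_left)
    also have "\<dots> = (\<Sum>i=0..n. fps_nth H i * fps_nth (fps_deriv F) (n - i))"
    proof (rule sum.cong[OF refl])
      fix i assume "i \<in> {0..n}"
      then have "(- 1) ^ n = ((- 1) ^ i * (- 1) ^ (n - i) :: 'a upoly)"
        by (simp flip: power_add)
      then have "(- 1) ^ n * (fps_nth G i * fps_nth (fps_deriv F) (n - i)) =
          ((- 1) ^ i * fps_nth G i) * ((- 1) ^ (n - i) * fps_nth (fps_deriv F) (n - i))"
        by (simp only: ac_simps)
      then show "(- 1) ^ n * (fps_nth G i * fps_nth (fps_deriv F) (n - i)) =
          fps_nth H i * fps_nth (fps_deriv F) (n - i)"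
        unfolding dF by (simp add: H_def)
    qed
    finally show "fps_nth (fps_deriv H) n = fps_nth (- (H * fps_deriv F)) n"
      by (simp only: fps_mult_nth fps_neg_nth)
  qed
  have "fps_deriv (H * G) = 0"
    by (simp only: fps_deriv_mult dG dH) (simp add: algebra_simps)
  then have "H * G = fps_const (fps_nth (H * G) 0)"
    by (simp only: fps_deriv_eq_0_iff)
  then have "fps_nth (H * G) n = 0"
    using assms by (metis fps_nth_fps_const less_numeral_extra(3))
  then show ?thesis
    by (simp add: fps_mult_nth H_def q)
qed

text \<open>
  The alternating sum over all products \<open>q\<^sub>i q\<^sub>j\<close> with \<open>i + j = a + b\<close>, split at \<open>i = a\<close>.
\<close>

lemma q_poly_orthogonality:
  assumes "a + b > 0"
  shows "(\<Sum>e=1..b. (- 1) ^ e * q_poly (a + e) * q_poly (b - e)) + q_poly a * q_poly b +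
    (\<Sum>e=1..a. (- 1) ^ e * q_poly (a - e) * q_poly (b + e)) = (0 :: 'a::field_char_0 upoly)"
proof -
  let ?g = "\<lambda>i. (- 1) ^ i * q_poly i * q_poly (a + b - i) :: 'a upoly"
  have "(\<Sum>i=0..a + b. ?g i) = (\<Sum>i\<in>{..<a}. ?g i) + (\<Sum>i\<in>{a}. ?g i) + (\<Sum>i\<in>{a<..a + b}. ?g i)"
  proof -
    have "{0..a + b} = ({..<a} \<union> {a}) \<union> {a<..a + b}" by auto
    then show ?thesis
      by (simp only:) (subst sum.union_disjoint; (auto)?)+
  qed
  also have "(\<Sum>i\<in>{..<a}. ?g i) = (\<Sum>e=1..a. (- 1) ^ a * ((- 1) ^ e * q_poly (a - e) * q_poly (b + e)))"
  proof (rule sum.reindex_bij_witness[of _ "\<lambda>e. a - e" "\<lambda>i. a - i"])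
    fix i assume i: "i \<in> {..<a}"
    then have "(- 1) ^ i = ((- 1) ^ a * (- 1) ^ (a - i) :: 'a upoly)"
      by (simp add: minus_one_power_iff)
    moreover have "b + (a - i) = a + b - i" using i by simp
    ultimately show "(- 1) ^ a * ((- 1) ^ (a - i) * q_poly (a - (a - i)) * q_poly (b + (a - i))) = ?g i"
      using i by (simp add: mult.assoc)
  qed auto
  also have "(\<Sum>i\<in>{a<..a + b}. ?g i) = (\<Sum>e=1..b. (- 1) ^ a * ((- 1) ^ e * q_poly (a + e) * q_poly (b - e)))"
  proof (rule sum.reindex_bij_witness[of _ "\<lambda>e. a + e" "\<lambda>i. i - a"])
    fix i assume i: "i \<in> {a<..a + b}"
    then have "(- 1) ^ i = ((- 1) ^ a * (- 1) ^ (i - a) :: 'a upoly)"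
      by (simp flip: power_add)
    moreover have "b - (i - a) = a + b - i" using i by simp
    ultimately show "(- 1) ^ a * ((- 1) ^ (i - a) * q_poly (a + (i - a)) * q_poly (b - (i - a))) = ?g i"
      using i by (simp add: mult.assoc)
  qed auto
  also have "(\<Sum>i=0..a + b. ?g i) = 0"
    using assms by (rule sum_alternating_q_poly)
  finally have "(- 1) ^ a * 0 = (- 1) ^ a * ((- 1) ^ a * ((\<Sum>e=1..b. (- 1) ^ e * q_poly (a + e) * q_poly (b - e)) +
      q_poly a * q_poly b + (\<Sum>e=1..a. (- 1) ^ e * q_poly (a - e) * q_poly (b + e))) :: 'a upoly)"
    by (simp add: sum_distrib_left distrib_left ac_simps)
  then show ?thesis by simp
qed

lemma sum_q_int_down:
  assumes "b \<le> m"
  shows "(\<Sum>e=1..m. (- 1) ^ e * (q_int (int a + int e) * q_int (int b - int e))) =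
    (\<Sum>e=1..b. (- 1) ^ e * q_poly (a + e) * q_poly (b - e) :: 'a::field_char_0 upoly)"
proof -
  have "(\<Sum>e=1..m. (- 1) ^ e * (q_int (int a + int e) * q_int (int b - int e))) =
      (\<Sum>e=1..b. (- 1) ^ e * (q_int (int a + int e) * q_int (int b - int e)) :: 'a upoly)"
    using assms by (intro sum.mono_neutral_right) auto
  also have "\<dots> = (\<Sum>e=1..b. (- 1) ^ e * q_poly (a + e) * q_poly (b - e))"
    by (intro sum.cong) (auto simp: mult.assoc simp flip: of_nat_add of_nat_diff)
  finally show ?thesis .
qed

text \<open>
  Orthogonality replaces \<open>q\<^sub>a q\<^sub>b\<close> plus one of the two copies of the sum in \<open>Q\<^sub>a\<^sub>,\<^sub>b\<close> by the negative
  of the sum with \<open>a\<close> and \<open>b\<close> exchanged.  The bound \<open>m\<close> of the summation is the same for all pairs,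
  as the minor summation formula needs.
\<close>

lemma Q_pair_eq_sum:
  assumes "a \<le> m" "b \<le> m"
  shows "Q_pair a b = (\<Sum>e=1..m. (- 1) ^ e * (q_int (int a + int e) * q_int (int b - int e) -
    q_int (int a - int e) * q_int (int b + int e)) :: 'a::field_char_0 upoly)"
proof -
  define R :: "nat \<Rightarrow> nat \<Rightarrow> 'a upoly" where
    "R a b = (\<Sum>e=1..m. (- 1) ^ e * (q_int (int a + int e) * q_int (int b - int e)))" for a b
  have R: "R a b = (\<Sum>e=1..b. (- 1) ^ e * q_poly (a + e) * q_poly (b - e))" if "b \<le> m" for a b
    unfolding R_def using that by (rule sum_q_int_down)
  have rhs: "(\<Sum>e=1..m. (- 1) ^ e * (q_int (int a + int e) * q_int (int b - int e) -
    q_int (int a - int e) * q_int (int b + int e))) = R a b - R b a"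
    by (simp add: R_def right_diff_distrib sum_subtractf mult.commute[of "q_int (int b + _)"])
  have gt: "Q_pair_gt a b = R a b - R b a" if "a > b" "a \<le> m" for a b
  proof -
    have "R a b + q_poly a * q_poly b + R b a = 0"
      using q_poly_orthogonality[of a b] that by (simp add: R ac_simps)
    moreover have "Q_pair_gt a b = q_poly a * q_poly b + 2 * R a b"
      using that by (simp add: Q_pair_gt_def R)
    ultimately show ?thesis by (simp add: algebra_simps add_eq_0_iff2)
  qed
  show ?thesis
    unfolding rhs using gt[of a b] gt[of b a] assms
    by (cases a b rule: linorder_cases) (auto simp: Q_pair_def)
qed


section \<open>Partitions in the index set\<close>


\<comment> \<open>keeps \<open>[1..<Suc m]\<close>, the list of the row indices \<open>j\<close>, in one piece\<close>
declare upt_Suc [simp del]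

text \<open>
  These are the partitions in the index set that have no part divisible by \<open>3\<close>.  The rows of the
  core \<open>c\<^bsub>-m\<^esub>\<close> selected by \<open>A\<close> end two nodes further to the right, just before the next node of
  color \<open>1\<close>, and \<open>b\<close> tells whether there is a new row.
\<close>

definition extended_core :: "nat \<Rightarrow> nat set \<Rightarrow> bool \<Rightarrow> nat list" where
  "extended_core m A b =
     map (\<lambda>j. if j \<in> A then 3 * j + 1 else 3 * j - 1) (rev [1..<Suc m]) @ (if b then [1] else [])"

lemma length_extended_core: "length (extended_core m A b) = m + of_bool b"
  by (simp add: extended_core_def)

lemma nth_extended_core:
  "i < m \<Longrightarrow> extended_core m A b ! i = (if m - i \<in> A then 3 * (m - i) + 1 else 3 * (m - i) - 1)"
  by (simp add: extended_core_def nth_append rev_nth Suc_diff_Suc)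

lemma nth_extended_core_last: "b \<Longrightarrow> extended_core m A b ! m = 1"
  by (simp add: extended_core_def nth_append)

lemma nth_c_neg: "i < m \<Longrightarrow> c_neg m ! i = 3 * (m - i) - 1"
  by (simp add: c_neg_def)

lemma length_c_neg: "length (c_neg m) = m"
  by (simp add: c_neg_def)

lemma c_neg_eq: "c_neg m = map (\<lambda>j. 3 * j - 1) (rev [1..<Suc m])"
  by (rule nth_equalityI) (simp_all add: c_neg_def rev_nth Suc_diff_Suc)

lemma set_extended_core:
  "set (extended_core m A b) =
     (\<lambda>j. if j \<in> A then 3 * j + 1 else 3 * j - 1) ` {1..m} \<union> (if b then {1} else {})"
  by (auto simp: extended_core_def)

lemma strict_partition_extended_core: "strict_partition (extended_core m A b)"
proof -
  let ?f = "\<lambda>j. if j \<in> A then 3 * j + 1 else 3 * j - 1"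
  have "sorted_wrt (\<lambda>x y. ?f x < ?f y) [1..<Suc m]"
    using sorted_wrt_upt by (rule sorted_wrt_mono_rel[rotated]) auto
  moreover have "1 < ?f j" if "j \<ge> 1" for j
    using that by auto
  ultimately have "sorted_wrt (>) (extended_core m A b)"
    by (auto simp: extended_core_def sorted_wrt_append sorted_wrt_map sorted_wrt_rev)
  moreover have "0 \<notin> set (extended_core m A b)"
    by (auto simp: set_extended_core)
  ultimately show ?thesis by (simp add: strict_partition_def)
qed

lemma sum_list_extended_core:
  assumes "A \<subseteq> {1..m}"
  shows "sum_list (extended_core m A b) = sum_list (c_neg m) + 2 * card A + of_bool b"
proof -
  have "sum_list (map (\<lambda>j. if j \<in> A then 3 * j + 1 else 3 * j - 1) (rev [1..<Suc m])) =
      (\<Sum>j\<in>{1..m}. (3 * j - 1) + 2 * (if j \<in> A then 1 else 0))"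
    by (simp only: rev_map sum_list_rev sum_list_distinct_conv_sum_set[OF distinct_upt] flip: rev_map)
      (auto intro!: sum.cong simp: sum_list_distinct_conv_sum_set atLeastLessThanSuc_atLeastAtMost)
  also have "\<dots> = (\<Sum>j\<in>{1..m}. 3 * j - 1) + 2 * card A"
  proof -
    have "(\<Sum>j\<in>{1..m}. 2 * (if j \<in> A then 1 else 0)) = 2 * card A"
      using assms by (simp add: sum_distrib_left[symmetric] Int_absorb1 flip: sum.inter_restrict)
    then show ?thesis by (simp only: sum.distrib)
  qed
  also have "(\<Sum>j\<in>{1..m}. 3 * j - 1) = sum_list (c_neg m)"
    unfolding c_neg_eq
    by (simp only: rev_map sum_list_rev flip: rev_map)
      (auto simp: sum_list_distinct_conv_sum_set atLeastLessThanSuc_atLeastAtMost)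
  finally show ?thesis
    by (simp add: extended_core_def)
qed

lemma inj_on_extended_core: "inj_on (\<lambda>A. extended_core m A b) (Pow {1..m})"
proof (rule inj_onI)
  fix A B assume AB: "A \<in> Pow {1..m}" "B \<in> Pow {1..m}" "extended_core m A b = extended_core m B b"
  have "j \<in> A \<longleftrightarrow> j \<in> B" if "j \<in> {1..m}" for j
  proof -
    have "extended_core m A b ! (m - j) = extended_core m B b ! (m - j)"
      using AB by simp
    then show ?thesis
      using that by (auto simp: nth_extended_core split: if_splits)
  qed
  then show "A = B" using AB by blast
qed

lemma extended_core_in_I0:
  assumes A: "A \<subseteq> {1..m}" "card A = n div 2"
  shows "extended_core m A (odd n) \<in> I0 n m"
proof -
  have "diagram (c_neg m) \<subseteq> diagram (extended_core m A (odd n))"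
    by (auto simp: diagram_def length_c_neg nth_c_neg length_extended_core nth_extended_core)
  moreover have "sum_list (extended_core m A (odd n)) = sum_list (c_neg m) + n"
    using A by (simp add: sum_list_extended_core)
  moreover have "color x = 0" if x: "x \<in> diagram (extended_core m A (odd n)) - diagram (c_neg m)" for x
  proof -
    obtain i j where ij: "x = (i, j)" by force
    have i: "i < m + of_bool (odd n)" and j: "1 \<le> j" "j \<le> extended_core m A (odd n) ! i"
      using x by (auto simp: ij diagram_def length_extended_core)
    show ?thesis
    proof (cases "i < m")
      case True
      then have "3 * (m - i) \<le> j" "j \<le> 3 * (m - i) + 1"
        using x j by (auto simp: ij diagram_def length_c_neg nth_c_neg nth_extended_core split: if_splits)
      then have "j mod 3 \<noteq> 2" by presburger
      then show ?thesis by (simp add: ij color_def)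
    next
      case False
      then have "odd n" "i = m" using i by (auto split: if_splits simp: of_bool_def)
      then show ?thesis
        using j by (simp add: ij color_def nth_extended_core_last)
    qed
  qed
  ultimately show ?thesis
    using strict_partition_extended_core by (simp add: I0_def)
qed

lemma bar_quotient0_eq_Nil_iff: "bar_quotient0 la = [] \<longleftrightarrow> (\<forall>x\<in>set la. x > 0 \<longrightarrow> x mod 3 \<noteq> 0)"
  by (auto simp: bar_quotient0_def parts_mod_def filter_empty_conv)

lemma mod_3_extended_row:
  fixes j :: nat
  shows "(3 * j + 1) mod 3 = 1" and "1 \<le> j \<Longrightarrow> (3 * j - 1) mod 3 = 2"
proof -
  show "(3 * j + 1) mod 3 = 1"
    using mod_mult_self4[of 3 j 1] by simp
  show "(3 * j - 1) mod 3 = 2" if "1 \<le> j"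
  proof -
    from that obtain i where "j = Suc i" by (cases j) auto
    then have "3 * j - 1 = 2 + 3 * i" by simp
    moreover have "(2 + 3 * i) mod 3 = 2"
      by (rule trans[OF mod_mult_self2]) simp
    ultimately show ?thesis by (simp only:)
  qed
qed

lemma bar_quotient0_extended_core: "bar_quotient0 (extended_core m A b) = []"
proof -
  show ?thesis
    using mod_3_extended_row
    by (auto simp: bar_quotient0_eq_Nil_iff set_extended_core)
qed

lemma row_length_cases:
  fixes t x :: nat
  assumes "3 * t - 1 \<le> x" "\<not> 3 * t + 2 \<le> x" "x mod 3 \<noteq> 0"
  shows "x = 3 * t - 1 \<or> x = 3 * t + 1"
proof -
  have "x \<noteq> 3 * t" using assms(3) by auto
  then show ?thesis using assms(1,2) by arith
qed

text \<open>
  After the row \<open>3j - 1\<close> of the core come two nodes of color \<open>0\<close> and then one of color \<open>1\<close>, and a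
  length divisible by \<open>3\<close> is excluded by the empty quotient; so each row grows by none or by two.
  A new row has to stop before column \<open>2\<close>, and strictness allows only one.  The parity of the number
  of added nodes tells whether it is there.
\<close>

lemma I0_bar_quotient0_Nil_imp_extended_core:
  assumes \<mu>: "\<mu> \<in> I0 n m" and q0: "bar_quotient0 \<mu> = []"
  obtains A where "A \<subseteq> {1..m}" "card A = n div 2" "\<mu> = extended_core m A (odd n)"
proof -
  have strict: "sorted_wrt (>) \<mu>" and pos: "0 \<notin> set \<mu>"
    and sub: "diagram (c_neg m) \<subseteq> diagram \<mu>"
    and sum: "sum_list \<mu> = sum_list (c_neg m) + n"
    and color: "\<forall>x \<in> diagram \<mu> - diagram (c_neg m). color x = 0"
    using \<mu> by (auto simp: I0_def strict_partition_def)
  have col: "j mod 3 \<noteq> 2" if "(i, j) \<in> diagram \<mu>" "(i, j) \<notin> diagram (c_neg m)" for i j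
    using bspec[OF color, of "(i, j)"] that by (auto simp: color_def)
  have core: "i < length \<mu>" "3 * (m - i) - 1 \<le> \<mu> ! i" if "i < m" for i
  proof -
    have "(i, 3 * (m - i) - 1) \<in> diagram (c_neg m)"
      using that by (auto simp: diagram_def length_c_neg nth_c_neg)
    then have "(i, 3 * (m - i) - 1) \<in> diagram \<mu>" using sub by blast
    then show "i < length \<mu>" "3 * (m - i) - 1 \<le> \<mu> ! i" by (auto simp: diagram_def)
  qed
  have row: "\<mu> ! i = 3 * (m - i) - 1 \<or> \<mu> ! i = 3 * (m - i) + 1" if "i < m" for i
  proof -
    have "\<not> 3 * (m - i) + 2 \<le> \<mu> ! i"
    proof
      assume "3 * (m - i) + 2 \<le> \<mu> ! i"
      then have "(3 * (m - i) + 2) mod 3 \<noteq> 2"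
        using that core by (intro col[of i]) (auto simp: diagram_def length_c_neg nth_c_neg)
      then show False using mod_mult_self4[of 3 "m - i" 2] by simp
    qed
    moreover have "\<mu> ! i mod 3 \<noteq> 0"
    proof -
      have mem: "\<mu> ! i \<in> set \<mu>" using core(1)[OF that] by simp
      then have "\<mu> ! i > 0" using pos by (metis gr0I)
      with mem q0 show ?thesis unfolding bar_quotient0_eq_Nil_iff by blast
    qed
    ultimately show ?thesis
      using core(2)[OF that] row_length_cases by blast
  qed
  have new_row: "\<mu> ! i = 1" if "m \<le> i" "i < length \<mu>" for i
  proof -
    have "\<not> 2 \<le> \<mu> ! i"
      using col[of i 2] that by (auto simp: diagram_def length_c_neg)
    moreover have "\<mu> ! i \<noteq> 0" using pos that by (metis nth_mem)
    ultimately show ?thesis by linarith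
  qed
  have "m \<le> length \<mu>"
    using core(1)[of "m - 1"] by (cases m) auto
  moreover have "length \<mu> \<le> m + 1"
  proof (rule ccontr)
    assume "\<not> length \<mu> \<le> m + 1"
    then have "\<mu> ! m > \<mu> ! (m + 1)"
      using sorted_wrt_nth_less[OF strict, of m "m + 1"] by simp
    then show False using new_row[of m] new_row[of "m + 1"] \<open>\<not> length \<mu> \<le> m + 1\<close> by simp
  qed
  ultimately have len: "length \<mu> = m + of_bool (length \<mu> = m + 1)" by auto
  define A where "A = {j \<in> {1..m}. \<mu> ! (m - j) = 3 * j + 1}"
  have A: "A \<subseteq> {1..m}" by (auto simp: A_def)
  have \<mu>_eq: "\<mu> = extended_core m A (length \<mu> = m + 1)"
  proof (rule nth_equalityI)
    show "length \<mu> = length (extended_core m A (length \<mu> = m + 1))"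
      using len by (simp add: length_extended_core)
    fix i assume i: "i < length \<mu>"
    show "\<mu> ! i = extended_core m A (length \<mu> = m + 1) ! i"
    proof (cases "i < m")
      case True
      then show ?thesis
        using row[OF True] by (auto simp: nth_extended_core A_def)
    next
      case False
      then have "i = m" "length \<mu> = m + 1" using i len by (auto simp: of_bool_def split: if_splits)
      then show ?thesis using new_row[of m] by (simp add: nth_extended_core_last)
    qed
  qed
  then have n: "n = 2 * card A + of_bool (length \<mu> = m + 1)"
    using sum sum_list_extended_core[OF A, of "length \<mu> = m + 1"] by simp
  then have "odd n \<longleftrightarrow> length \<mu> = m + 1" "card A = n div 2"
    by auto
  then show ?thesis
    using that[OF A] \<mu>_eq by simp
qed

lemma I0_bar_quotient0_Nil_eq:
  "{\<mu>. \<mu> \<in> I0 n m \<and> bar_quotient0 \<mu> = []} =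
    (\<lambda>A. extended_core m A (odd n)) ` {A. A \<subseteq> {1..m} \<and> card A = n div 2}"
  using extended_core_in_I0 bar_quotient0_extended_core
  by (auto elim!: I0_bar_quotient0_Nil_imp_extended_core)

lemma parts_mod_1_extended_core:
  "parts_mod 1 (extended_core m A b) =
    map (\<lambda>j. 3 * j + 1) (rev (filter (\<lambda>j. j \<in> A) [1..<Suc m])) @ (if b then [1] else [])"
proof -
  have "(if j \<in> A then 3 * j + 1 else 3 * j - 1) mod 3 = 1 \<longleftrightarrow> j \<in> A" if "j \<in> set (rev [1..<Suc m])" for j
  proof -
    have "j \<ge> 1" using that by simp
    then show ?thesis using mod_3_extended_row[of j] by simp
  qed
  then have "parts_mod 1 (map (\<lambda>j. if j \<in> A then 3 * j + 1 else 3 * j - 1) (rev [1..<Suc m])) =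
      map (\<lambda>j. if j \<in> A then 3 * j + 1 else 3 * j - 1) (filter (\<lambda>j. j \<in> A) (rev [1..<Suc m]))"
    unfolding parts_mod_def filter_map comp_def by (intro arg_cong[where f = "map _"] filter_cong) auto
  also have "\<dots> = map (\<lambda>j. 3 * j + 1) (filter (\<lambda>j. j \<in> A) (rev [1..<Suc m]))"
    by (rule map_cong) auto
  finally show ?thesis
    unfolding extended_core_def rev_filter by (auto simp: parts_mod_def)
qed

lemma parts_mod_2_extended_core:
  "parts_mod 2 (extended_core m A b) = map (\<lambda>j. 3 * j - 1) (rev (filter (\<lambda>j. j \<notin> A) [1..<Suc m]))"
proof -
  have "(if j \<in> A then 3 * j + 1 else 3 * j - 1) mod 3 = 2 \<longleftrightarrow> j \<notin> A" if "j \<in> set (rev [1..<Suc m])" for j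
  proof -
    have "j \<ge> 1" using that by simp
    then show ?thesis using mod_3_extended_row[of j] by simp
  qed
  then have "parts_mod 2 (map (\<lambda>j. if j \<in> A then 3 * j + 1 else 3 * j - 1) (rev [1..<Suc m])) =
      map (\<lambda>j. if j \<in> A then 3 * j + 1 else 3 * j - 1) (filter (\<lambda>j. j \<notin> A) (rev [1..<Suc m]))"
    unfolding parts_mod_def filter_map comp_def by (intro arg_cong[where f = "map _"] filter_cong) auto
  also have "\<dots> = map (\<lambda>j. 3 * j - 1) (filter (\<lambda>j. j \<notin> A) (rev [1..<Suc m]))"
    by (rule map_cong) auto
  finally show ?thesis
    unfolding extended_core_def rev_filter by (auto simp: parts_mod_def)
qed

lemma parts_mod_0_extended_core: "parts_mod 0 (extended_core m A b) = []"
proof -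
  have "x mod 3 \<noteq> 0" if "x \<in> set (extended_core m A b)" for x
    using that bar_quotient0_extended_core[of m A b] strict_partition_extended_core[of m A b]
    by (cases "x = 0") (simp_all add: bar_quotient0_eq_Nil_iff strict_partition_def)
  then show ?thesis
    by (auto simp: parts_mod_def filter_empty_conv)
qed

lemma filter_mem_upt:
  assumes "A \<subseteq> {1..m}"
  shows "filter (\<lambda>j. j \<in> A) [1..<Suc m] = sorted_list_of_set A"
proof -
  have "set (filter (\<lambda>j. j \<in> A) [1..<Suc m]) = A" using assms by auto
  moreover have "sorted_wrt (<) (filter (\<lambda>j. j \<in> A) [1..<Suc m])"
    by (intro sorted_wrt_filter sorted_wrt_upt)
  ultimately show ?thesis
    by (metis strict_sorted_equal strict_sorted_list_of_set set_sorted_list_of_set List.finite_set)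
qed

lemma length_filter_not_mem_upt:
  assumes "A \<subseteq> {1..m}"
  shows "length (filter (\<lambda>j. j \<notin> A) [1..<Suc m]) = m - card A"
  using sum_length_filter_compl[of "\<lambda>j. j \<in> A" "[1..<Suc m]"] assms by (simp only: filter_mem_upt) simp

text \<open>
  The symmetric set \<open>A \<union> -A\<close> or \<open>A \<union> {0} \<union> -A\<close> as the decreasing sequence in which both the
  numbers that define \<open>\<mu>[1]\<close> and the rows of the minors are listed.
\<close>

definition symmetric_set_list :: "nat set \<Rightarrow> bool \<Rightarrow> int list" where
  "symmetric_set_list A b =
     rev (map int (sorted_list_of_set A)) @ (if b then [0] else []) @
     map (\<lambda>j. - int j) (sorted_list_of_set A)"

lemma length_symmetric_set_list: "length (symmetric_set_list A b) = 2 * card A + of_bool b"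
  by (simp add: symmetric_set_list_def)

text \<open>
  The lengthened rows \<open>3j + 1\<close> contribute \<open>j\<close>.  The unchanged rows \<open>3j - 1\<close> delete \<open>-j\<close>, so that
  exactly the \<open>-j\<close> with \<open>j \<in> A\<close> survive.
\<close>

lemma maya_extended_core:
  assumes A: "A \<subseteq> {1..m}"
  shows "maya m (extended_core m A b) = symmetric_set_list A b"
proof -
  let ?D = "(\<lambda>x. - ((int x + 1) div 3)) ` set (parts_mod 2 (extended_core m A b))"
  have "?D = (\<lambda>j. - int j) ` ({1..m} - A)"
  proof -
    have "(int (3 * j - 1) + 1) div 3 = int j" if "1 \<le> j" for j
      using that by (simp add: of_nat_diff)
    then show ?thesis
      by (auto simp: parts_mod_2_extended_core image_image intro!: image_eqI)
  qed
  then have "filter (\<lambda>b. b \<notin> ?D) (map (\<lambda>i. - int i) [1..<m + 1]) =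
      map (\<lambda>i. - int i) (filter (\<lambda>j. j \<in> A) [1..<Suc m])"
    unfolding filter_map comp_def using A by (intro arg_cong[where f = "map _"] filter_cong) auto
  moreover have "map (\<lambda>x. (int x - 1) div 3) (parts_mod 1 (extended_core m A b)) =
      rev (map int (sorted_list_of_set A)) @ (if b then [0] else [])"
    unfolding parts_mod_1_extended_core filter_mem_upt[OF A] by (simp add: rev_map)
  ultimately show ?thesis
    by (simp add: maya_def symmetric_set_list_def filter_mem_upt[OF A, unfolded One_nat_def])
qed

lemma bar_quotient1_extended_core:
  assumes A: "A \<subseteq> {1..m}" "card A = n div 2"
  shows "bar_quotient1 m (extended_core m A (odd n)) =
    map (\<lambda>i. symmetric_set_list A (odd n) ! i + (int m - int n + 1) + int i) [0..<n]"
proof -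
  have le: "card A \<le> m"
    using card_mono[OF _ A(1)] by simp
  have "int (length (parts_mod 1 (extended_core m A (odd n)))) -
      int (length (parts_mod 2 (extended_core m A (odd n)))) =
      int (card A + of_bool (odd n)) - int (m - card A)"
    unfolding parts_mod_1_extended_core parts_mod_2_extended_core filter_mem_upt[OF A(1)]
      length_map length_rev length_append length_filter_not_mem_upt[OF A(1)]
    by simp
  also have "\<dots> = int (2 * card A + of_bool (odd n)) - int m"
    using le by (simp add: of_nat_diff)
  also have "2 * card A + of_bool (odd n) = n"
    using A(2) by simp
  finally have d: "int (length (parts_mod 1 (extended_core m A (odd n)))) -
      int (length (parts_mod 2 (extended_core m A (odd n)))) = int n - int m" .
  have len: "length (symmetric_set_list A (odd n)) = n"
    using A(2) by (simp add: length_symmetric_set_list)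
  show ?thesis
    unfolding bar_quotient1_def d maya_extended_core[OF A(1)] Let_def len
    by (intro map_cong refl) simp
qed

lemma admissible_extended_core: "admissible m (extended_core m A b)"
proof -
  have "x + 1 \<le> 3 * m" if "x \<in> set (parts_mod 2 (extended_core m A b))" for x
    using that by (auto simp: parts_mod_2_extended_core)
  then show ?thesis
    by (simp add: admissible_def)
qed

lemma even_form_extended_core:
  "even_form (extended_core m A (odd n)) =
    extended_core m A (odd n) @ (if odd (m + n) then [0] else [])"
proof -
  have "filter (\<lambda>x. x > 0) (extended_core m A (odd n)) = extended_core m A (odd n)"
    using strict_partition_extended_core[of m A "odd n"]
    by (auto simp: strict_partition_def filter_id_conv intro!: gr0I)
  then show ?thesis
    by (simp add: even_form_def length_extended_core)
qed

text \<open>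
  The right-hand sign is the one that the minor summation formula produces: the weights give the sum
  of \<open>A\<close>, the auxiliary row for odd \<open>n\<close> gives \<open>n div 2\<close>, and reversing the columns gives
  \<open>n choose 2\<close>.  The comparison rests on \<open>f + (m - r) + 3 \<Sum>A = 3 m (m + 1) / 2\<close>,
  where \<open>r = card A\<close> and \<open>f\<close> is the sum of the \<open>m - r\<close> unchanged parts \<open>3j - 1\<close>: both sides
  are the sum of \<open>3j\<close> over \<open>j \<le> m\<close>.
\<close>

lemma delta0_extended_core:
  assumes A: "A \<subseteq> {1..m}" "card A = n div 2"
  shows "(- 1) ^ ((m + 1) * (m + 2 * n) div 2) * delta0 m (extended_core m A (odd n)) =
    (- 1) ^ (\<Sum>A + (if odd n then n div 2 else 0) + (n choose 2))"
proof -
  let ?\<mu> = "extended_core m A (odd n)"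
  define r where "r = n div 2"
  define T where "T = (\<Sum>j=1..m. j)"
  define f where "f = (\<Sum>j\<in>{1..m} - A. 3 * j - 1)"
  have r: "r \<le> m" "card A = r"
    using card_mono[OF _ A(1)] A(2) by (simp_all add: r_def)
  have parts2: "parts_mod 2 (even_form ?\<mu>) = parts_mod 2 ?\<mu>"
    by (simp add: even_form_extended_core parts_mod_def)
  have parts1: "parts_mod 1 (even_form ?\<mu>) = parts_mod 1 ?\<mu>"
    by (simp add: even_form_extended_core parts_mod_def)
  have parts0: "parts_mod 0 (even_form ?\<mu>) = (if odd (m + n) then [0] else [])"
    using parts_mod_0_extended_core[of m A "odd n"] by (auto simp: even_form_extended_core parts_mod_def)
  have "set (filter (\<lambda>j. j \<notin> A) [1..<Suc m]) = {1..m} - A"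
    by auto
  then have f_stat: "f_stat ?\<mu> = f"
    unfolding f_stat_def parts2 parts_mod_2_extended_core f_def
    by (simp add: rev_map[symmetric] sum_list_distinct_conv_sum_set del: set_upt set_filter)
  have h_stat: "h_stat ?\<mu> = m - r"
    unfolding h_stat_def parts2 parts_mod_2_extended_core
    using length_filter_not_mem_upt[OF A(1)] r by simp
  have "filter (\<lambda>y. y > 0) (parts_mod 1 ?\<mu>) = parts_mod 1 ?\<mu>"
  proof -
    have "y > 0" if "y \<in> set (parts_mod 1 ?\<mu>)" for y
      by (rule gr0I) (use that in \<open>simp add: parts_mod_def\<close>)
    then show ?thesis by (simp add: filter_id_conv)
  qed
  then have g_stat: "g_stat ?\<mu> = (if odd (m + n) then r + of_bool (odd n) else 0)"
    unfolding g_stat_def parts0 parts1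
    by (simp add: parts_mod_1_extended_core filter_mem_upt[OF A(1)] r del: One_nat_def)
  have T2: "2 * T = m * (m + 1)"
    unfolding T_def using gauss_sum_from_Suc_0[of m, where ?'a = nat] by (simp add: mult.commute)
  have "(m + 1) * (m + 2 * n) = 2 * (T + n * (m + 1))"
    using T2 by (simp add: algebra_simps)
  then have e: "(m + 1) * (m + 2 * n) div 2 = T + n * (m + 1)"
    by simp
  have f: "f + (m - r) + 3 * \<Sum>A = 3 * T"
  proof -
    have "card ({1..m} - A) = m - r"
      using A(1) r by (simp add: card_Diff_subset finite_subset)
    then have "f + (m - r) = f + (\<Sum>j\<in>{1..m} - A. 1)"
      by simp
    also have "\<dots> = (\<Sum>j\<in>{1..m} - A. (3 * j - 1) + 1)"
      unfolding f_def by (rule sum.distrib[symmetric])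
    also have "\<dots> = 3 * \<Sum>({1..m} - A)"
      by (auto simp: sum_distrib_left intro!: sum.cong)
    finally show ?thesis
      using sum.subset_diff[OF A(1), of "\<lambda>j. j"] by (simp add: T_def)
  qed
  have n: "n = 2 * r + of_bool (odd n)"
    by (simp add: r_def)
  have choose: "even (n choose 2) \<longleftrightarrow> even r"
  proof (cases "odd n")
    case True
    then have "n * (n - 1) = 2 * ((2 * r + 1) * r)" using n by (simp add: algebra_simps)
    then show ?thesis by (simp add: choose_two)
  next
    case False
    then have "n = 2 * r" using n by simp
    then show ?thesis by (cases r) (simp_all add: choose_two)
  qed
  have parity: "even (T + n * (m + 1) + (f_stat ?\<mu> + g_stat ?\<mu> + (if odd m then h_stat ?\<mu> else 0))) \<longleftrightarrow>
      even (\<Sum>A + (if odd n then r else 0) + (n choose 2))"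
  proof -
    have "even (f + (m - r) + 3 * \<Sum>A) \<longleftrightarrow> even (3 * T)" using f by simp
    then have "even f \<longleftrightarrow> (even T \<longleftrightarrow> (even m \<longleftrightarrow> (even r \<longleftrightarrow> even (\<Sum>A))))"
      using r(1) by (simp add: even_diff_nat) blast
    then show ?thesis
      unfolding f_stat g_stat h_stat using choose r(1) by (simp add: even_diff_nat) blast
  qed
  have "(- 1) ^ ((m + 1) * (m + 2 * n) div 2) * delta0 m ?\<mu> =
      (- 1) ^ (T + n * (m + 1) + (f_stat ?\<mu> + g_stat ?\<mu> + (if odd m then h_stat ?\<mu> else 0)))"
    unfolding e by (simp add: delta0_def power_add)
  also have "\<dots> = (- 1) ^ (\<Sum>A + (if odd n then r else 0) + (n choose 2))"
    using parity by (simp only: minus_one_power_iff)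
  finally show ?thesis by (simp add: r_def)
qed

lemma length_maya:
  assumes strict: "strict_partition la" and adm: "admissible k la"
  shows "length (maya k la) + length (parts_mod 2 la) = length (parts_mod 1 la) + k"
proof -
  let ?D = "(\<lambda>x. - ((int x + 1) div 3)) ` set (parts_mod 2 la)"
  let ?bs = "map (\<lambda>i. - int i) [1..<k + 1]"
  have sorted: "sorted_wrt (>) (parts_mod 2 la)"
    using strict by (auto simp: strict_partition_def parts_mod_def intro: sorted_wrt_filter)
  have exact: "\<exists>j\<in>{1..k}. x = 3 * j - 1" if "x \<in> set (parts_mod 2 la)" for x
  proof -
    have "x \<le> hd (parts_mod 2 la)"
      using that sorted by (cases "parts_mod 2 la") auto
    moreover have "hd (parts_mod 2 la) + 1 \<le> 3 * k"
      using adm that by (auto simp: admissible_def)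
    moreover have "x mod 3 = 2"
      using that by (simp add: parts_mod_def)
    moreover from this have "x = 3 * (x div 3) + 2"
      by (metis mult_div_mod_eq)
    ultimately show ?thesis
      by (intro bexI[of _ "x div 3 + 1"]) auto
  qed
  have "inj_on (\<lambda>x. - ((int x + 1) div 3)) (set (parts_mod 2 la))"
  proof (rule inj_onI)
    fix x y assume xy: "x \<in> set (parts_mod 2 la)" "y \<in> set (parts_mod 2 la)"
      "- ((int x + 1) div 3) = - ((int y + 1) div 3)"
    obtain i j where "x = 3 * i - 1" "y = 3 * j - 1" "i \<ge> 1" "j \<ge> 1"
      using exact[OF xy(1)] exact[OF xy(2)] by auto
    then show "x = y" using xy(3) by (simp add: of_nat_diff)
  qed
  moreover have "distinct (parts_mod 2 la)"
    using sorted by (auto simp: distinct_conv_nth sorted_wrt_iff_nth_less)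
      (metis less_irrefl linorder_neqE_nat)
  ultimately have card_D: "card ?D = length (parts_mod 2 la)"
    by (simp add: card_image distinct_card)
  have "?D \<subseteq> set ?bs"
  proof
    fix b assume "b \<in> ?D"
    then obtain x where x: "x \<in> set (parts_mod 2 la)" "b = - ((int x + 1) div 3)" by blast
    then obtain j where j: "j \<in> {1..k}" "x = 3 * j - 1" using exact by blast
    then have "b = - int j" using x(2) by (simp add: of_nat_diff)
    then show "b \<in> set ?bs" using j(1) by auto
  qed
  then have "set (filter (\<lambda>b. b \<in> ?D) ?bs) = ?D"
    by auto
  moreover have "distinct ?bs"
    by (simp add: distinct_map inj_on_def)
  ultimately have "length (filter (\<lambda>b. b \<in> ?D) ?bs) = length (parts_mod 2 la)"
    using card_D by (metis distinct_card distinct_filter)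
  moreover have "length (filter (\<lambda>b. b \<in> ?D) ?bs) + length (filter (\<lambda>b. b \<notin> ?D) ?bs) = k"
    using sum_length_filter_compl[of "\<lambda>b. b \<in> ?D" ?bs] by simp
  ultimately show ?thesis
    by (simp add: maya_def)
qed

text \<open>
  Raising \<open>k\<close> appends \<open>-(k + 1)\<close> to the sequence, and the shift at its end cancels it.
\<close>

lemma bar_quotient1_Suc:
  assumes strict: "strict_partition la" and adm: "admissible k la"
  shows "bar_quotient1 (Suc k) la = bar_quotient1 k la @ [0]"
proof -
  let ?D = "(\<lambda>x. - ((int x + 1) div 3)) ` set (parts_mod 2 la)"
  have "- int (Suc k) \<notin> ?D"
  proof
    assume "- int (Suc k) \<in> ?D"
    then obtain x where x: "x \<in> set (parts_mod 2 la)" "int (Suc k) = (int x + 1) div 3" by force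
    have "sorted_wrt (>) (parts_mod 2 la)"
      using strict by (auto simp: strict_partition_def parts_mod_def intro: sorted_wrt_filter)
    then have "x \<le> hd (parts_mod 2 la)"
      using x(1) by (cases "parts_mod 2 la") auto
    moreover have "hd (parts_mod 2 la) + 1 \<le> 3 * k"
      using adm x(1) by (auto simp: admissible_def)
    ultimately show False using x(2) by linarith
  qed
  then have maya_Suc: "maya (Suc k) la = maya k la @ [- int (Suc k)]"
    by (simp add: maya_def upt_Suc)
  have len: "int (length (maya k la)) =
      int (length (parts_mod 1 la)) - int (length (parts_mod 2 la)) + int k"
    using length_maya[OF assms] by linarith
  show ?thesis
    unfolding bar_quotient1_def Let_def maya_Suc using len
    by (auto simp: nth_append upt_Suc intro!: map_cong)
qed

declare upt_Suc [simp]


section \<open>Independence of the parameter \<open>k\<close>\<close>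


lemma schur_S_odd_snoc_0: "schur_S_odd (la @ [0]) = (schur_S_odd la :: 'a::field_char_0 upoly)"
proof -
  let ?f = "\<lambda>i j. q_int ((la @ [0]) ! i + int j - int i) :: 'a upoly"
  have "det (mat (Suc (length la)) (Suc (length la)) (\<lambda>(i, j). ?f i j)) =
      det (mat (length la) (length la) (\<lambda>(i, j). ?f i j))"
    by (rule det_last_row_unit) auto
  also have "\<dots> = schur_S_odd la"
    unfolding schur_S_odd_eq_det by (intro arg_cong[where f = det] eq_matI) (auto simp: nth_append)
  finally show ?thesis
    by (simp add: schur_S_odd_eq_det)
qed

text \<open>
  A larger \<open>k\<close> only adds trailing zeros to the quotient, and each of them adds a last row
  \<open>(0, \<dots>, 0, 1)\<close> to the Jacobi-Trudi determinant.
\<close>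

lemma schur_S_odd_bar_quotient1_eq:
  assumes strict: "strict_partition la" and adm: "admissible k la" "admissible k' la"
  shows "schur_S_odd (bar_quotient1 k la) = (schur_S_odd (bar_quotient1 k' la) :: 'a::field_char_0 upoly)"
proof -
  have up: "schur_S_odd (bar_quotient1 (k + d) la) = (schur_S_odd (bar_quotient1 k la) :: 'a upoly)"
    if "admissible k la" for k d
  proof (induction d)
    case (Suc d)
    have "admissible (k + d) la"
      using that by (auto simp: admissible_def)
    then show ?case
      using Suc bar_quotient1_Suc[OF strict] by (simp add: schur_S_odd_snoc_0)
  qed simp
  show ?thesis
    using up[OF adm(1), of "k' - k"] up[OF adm(2), of "k - k'"] by (cases "k \<le> k'") auto
qed


section \<open>Staircase \<open>Q\<close>-functions as sums of minors\<close>


lemma length_Delta: "length (Delta m n) = n"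
  by (simp add: Delta_def)

lemma nth_Delta: "i < n \<Longrightarrow> Delta m n ! i = m - i"
  by (simp add: Delta_def)

lemma filter_pos_Delta: "n \<le> m \<Longrightarrow> filter (\<lambda>x. x > 0) (Delta m n) = Delta m n"
  by (auto simp: Delta_def filter_id_conv)

lemma Delta_Suc_self: "Delta m (Suc m) = Delta m m @ [0]"
  by (simp add: Delta_def)

lemma schur_Q_Delta_even:
  assumes "even n" "n \<le> m + 1"
  shows "(schur_Q (Delta m n) :: 'a::field_char_0 upoly) =
    pfaffian (n div 2) (\<lambda>i j. Q_pair (m - i) (m - j))"
proof -
  have ef: "even_form (Delta m n) = Delta m n"
  proof (cases "n \<le> m")
    case True
    then show ?thesis
      using assms(1) by (simp add: even_form_def filter_pos_Delta length_Delta)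
  next
    case False
    then have "n = Suc m" using assms(2) by simp
    then show ?thesis
      using assms(1) filter_pos_Delta[of m m] by (simp add: even_form_def Delta_Suc_self length_Delta)
  qed
  show ?thesis
    unfolding schur_Q_def ef Let_def length_Delta using assms(1)
    by (intro pfaffian_cong) (auto simp: nth_Delta)
qed

lemma schur_Q_Delta_odd:
  assumes "odd n" "n \<le> m"
  shows "(schur_Q (Delta m n) :: 'a::field_char_0 upoly) =
    pfaffian (Suc (n div 2)) (\<lambda>i j. Q_pair (if i < n then m - i else 0) (if j < n then m - j else 0))"
proof -
  have ef: "even_form (Delta m n) = Delta m n @ [0]"
    using assms by (simp add: even_form_def filter_pos_Delta length_Delta)
  have len: "length (Delta m n @ [0]) div 2 = Suc (n div 2)"
    using assms(1) by (auto simp: length_Delta elim!: oddE)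
  have nth: "(Delta m n @ [0]) ! i = (if i < n then m - i else 0)" if "i < 2 * Suc (n div 2)" for i
    using that assms(1) by (auto simp: nth_append length_Delta nth_Delta less_Suc_eq elim!: oddE)
  show ?thesis
    unfolding schur_Q_def ef Let_def len by (intro pfaffian_cong) (simp only: nth)
qed

text \<open>
  For even \<open>m\<close> the part \<open>0\<close> of the staircase \<open>(m, \<dots>, 1, 0)\<close> is dropped without replacement.
\<close>

lemma schur_Q_Delta_Suc:
  assumes "even m"
  shows "(schur_Q (Delta m (Suc m)) :: 'a::field_char_0 upoly) =
    pfaffian (m div 2) (\<lambda>i j. Q_pair (m - i) (m - j))"
proof -
  have "schur_Q (Delta m (Suc m)) = (schur_Q (Delta m m) :: 'a upoly)"
    by (simp add: schur_Q_def even_form_def Delta_Suc_self)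
  then show ?thesis
    using schur_Q_Delta_even[OF assms, of m] by simp
qed

text \<open>
  The columns of the minor are indexed by the parts \<open>m - j\<close> of the staircase in decreasing order,
  those of the Jacobi-Trudi determinant in increasing order.
\<close>

lemma det_of_symmetric_rows:
  assumes "n \<le> m + 1" "length M = n"
  shows "det_of_rows (map (\<lambda>s j. q_int (int m + s - int j)) M) =
    (- 1) ^ (n choose 2) *
      (schur_S_odd (map (\<lambda>i. M ! i + (int m - int n + 1) + int i) [0..<n]) :: 'a::field_char_0 upoly)"
proof -
  let ?f = "\<lambda>i j. q_int (M ! i + (int m - int n + 1) + int j) :: 'a upoly"
  have "det_of_rows (map (\<lambda>s j. q_int (int m + s - int j)) M) = det (mat n n (\<lambda>(i, j). ?f i (n - 1 - j)))"
    unfolding det_of_rows_def using assms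
    by (intro arg_cong[where f = det] eq_matI) (auto simp: of_nat_diff algebra_simps)
  also have "\<dots> = (- 1) ^ (n choose 2) * det (mat n n (\<lambda>(i, j). ?f i j))"
    by (rule det_reverse_columns)
  also have "det (mat n n (\<lambda>(i, j). ?f i j)) =
      schur_S_odd (map (\<lambda>i. M ! i + (int m - int n + 1) + int i) [0..<n])"
    unfolding schur_S_odd_eq_det using assms
    by (intro arg_cong[where f = det] eq_matI) (auto simp: algebra_simps)
  finally show ?thesis .
qed

lemma det_of_rows_zero_column:
  assumes "j < length rs" "\<And>r. r \<in> set rs \<Longrightarrow> r j = 0"
  shows "det_of_rows rs = 0"
proof -
  let ?M = "mat (length rs) (length rs) (\<lambda>(i, j). (rs ! i) j)"
  have "det ?M = (\<Sum>i<length rs. ?M $$ (i, j) * cofactor ?M i j)"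
    using assms(1) by (intro laplace_expansion_column) auto
  also have "\<dots> = 0"
  proof (rule sum.neutral, rule ballI)
    fix i assume i: "i \<in> {..<length rs}"
    then have "(rs ! i) j = 0" by (intro assms(2)) simp
    then show "?M $$ (i, j) * cofactor ?M i j = 0" using i assms(1) by simp
  qed
  finally show ?thesis by (simp add: det_of_rows_def)
qed

lemma schur_Q_Delta_eq_sum_even:
  assumes n: "even n" "n \<le> m + 1"
  shows "(schur_Q (Delta m n) :: 'a::field_char_0 upoly) =
    (\<Sum>A | A \<subseteq> {1..m} \<and> card A = n div 2. (- 1) ^ (\<Sum>A) *
       det_of_rows (map (\<lambda>s j. q_int (int m + s - int j)) (symmetric_set_list A False)))"
proof -
  define T1 T2 :: "nat \<Rightarrow> nat \<Rightarrow> 'a upoly" where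
    "T1 e j = q_int (int m + int e - int j)" and "T2 e j = q_int (int m + - int e - int j)" for e j
  have "schur_Q (Delta m n) = pfaffian (n div 2) (\<lambda>i j. Q_pair (m - i) (m - j) :: 'a upoly)"
    using n by (rule schur_Q_Delta_even)
  also have "\<dots> = pfaffian (n div 2) (\<lambda>i j. \<Sum>e=1..m. (- 1) ^ e * (T1 e i * T2 e j - T2 e i * T1 e j))"
  proof (rule pfaffian_cong)
    fix i j assume "i < 2 * (n div 2)" "j < 2 * (n div 2)"
    then have "i \<le> m" "j \<le> m" using n by auto
    then show "Q_pair (m - i) (m - j) = (\<Sum>e=1..m. (- 1) ^ e * (T1 e i * T2 e j - T2 e i * T1 e j))"
      by (subst Q_pair_eq_sum[of _ m]) (auto simp: T1_def T2_def of_nat_diff algebra_simps)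
  qed
  also have "\<dots> = (\<Sum>A | A \<subseteq> {1..m} \<and> card A = n div 2. (\<Prod>e\<in>A. (- 1) ^ e) *
      det_of_rows (concat (map (\<lambda>e. [T1 e, T2 e]) (sorted_list_of_set A))))"
    by (rule pfaffian_minor_summation) simp
  also have "\<dots> = (\<Sum>A | A \<subseteq> {1..m} \<and> card A = n div 2. (- 1) ^ (\<Sum>A) *
       det_of_rows (map (\<lambda>s j. q_int (int m + s - int j)) (symmetric_set_list A False)))"
  proof (rule sum.cong[OF refl])
    fix A :: "nat set"
    let ?as = "sorted_list_of_set A"
    have "map (\<lambda>s j. q_int (int m + s - int j)) (symmetric_set_list A False) =
        rev (map T1 ?as) @ map T2 ?as"
      by (simp add: symmetric_set_list_def T1_def[abs_def] T2_def[abs_def] rev_map)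
    then show "(\<Prod>e\<in>A. (- 1) ^ e) * det_of_rows (concat (map (\<lambda>e. [T1 e, T2 e]) ?as)) =
      (- 1) ^ (\<Sum>A) * det_of_rows (map (\<lambda>s j. q_int (int m + s - int j)) (symmetric_set_list A False))"
      using det_of_rows_unzip_pairs[of "[]" T1 T2 ?as "[]"] by (simp add: power_sum)
  qed
  finally show ?thesis .
qed

text \<open>
  The Pfaffian now has the \<open>n\<close> columns of the staircase and one more for the appended part \<open>0\<close>.
  The row \<open>T1 0\<close>, which has the entry \<open>q\<^bsub>m - j\<^esub> = Q\<^bsub>m - j, 0\<^esub>\<close> in column \<open>j < m\<close>, is coupled
  to an auxiliary row \<open>T2 0\<close> that is supported in column \<open>n\<close>, except for one correction.  All other
  rows vanish in column \<open>n\<close>, so only sets of couples that contain this one contribute.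

  The correction concerns \<open>n = m + 1\<close>, where column \<open>m\<close> belongs to a part \<open>0\<close> of the staircase and
  the Pfaffian to be computed has the size \<open>m\<close> instead of \<open>m + 2\<close>.  The entry \<open>- 1\<close> of the auxiliary
  row in column \<open>m\<close> amounts to subtracting the last column from column \<open>m\<close>; it makes column \<open>m\<close>
  zero above the pair \<open>(m, m + 1)\<close>, so that the Pfaffian reduces to the first \<open>m\<close> indices.
\<close>

lemma schur_Q_Delta_eq_sum_odd:
  assumes n: "odd n" "n \<le> m + 1"
  shows "(schur_Q (Delta m n) :: 'a::field_char_0 upoly) =
    (\<Sum>A | A \<subseteq> {1..m} \<and> card A = n div 2. (- 1) ^ (\<Sum>A + n div 2) *
       det_of_rows (map (\<lambda>s j. q_int (int m + s - int j)) (symmetric_set_list A True)))"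
proof -
  define T1 :: "nat \<Rightarrow> nat \<Rightarrow> 'a upoly" where
    "T1 e j = (if j < n then q_int (int m + int e - int j) else 0)" for e j
  \<comment> \<open>Column \<open>m\<close> precedes column \<open>n\<close> only if \<open>n = m + 1\<close>.\<close>
  define T2 :: "nat \<Rightarrow> nat \<Rightarrow> 'a upoly" where
    "T2 e j = (if e = 0 then if j = n then 1 else if j = m then - 1 else 0
      else if j < n then q_int (int m - int e - int j) else 0)" for e j
  let ?C = "\<lambda>i j. \<Sum>e=0..m. (- 1) ^ e * (T1 e i * T2 e j - T2 e i * T1 e j)"
  have C_split: "?C i j = (T1 0 i * T2 0 j - T2 0 i * T1 0 j) +
      (\<Sum>e=1..m. (- 1) ^ e * (T1 e i * T2 e j - T2 e i * T1 e j))" for i j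
    by (subst sum.atLeast_Suc_atMost) simp_all
  have C_inner: "(\<Sum>e=1..m. (- 1) ^ e * (T1 e i * T2 e j - T2 e i * T1 e j)) = Q_pair (m - i) (m - j)"
    if "i < n" "j < n" for i j
    using that n(2) by (subst Q_pair_eq_sum[of _ m]) (auto simp: T1_def T2_def of_nat_diff algebra_simps)
  have C_outer: "(\<Sum>e=1..m. (- 1) ^ e * (T1 e i * T2 e j - T2 e i * T1 e j)) = 0"
    if "n \<le> i \<or> n \<le> j" for i j
    using that by (intro sum.neutral) (auto simp: T1_def T2_def)
  have Q0: "Q_pair a 0 = (q_poly a :: 'a upoly)" if "a > 0" for a
    using that by (simp add: Q_pair_def Q_pair_gt_def)
  have q_diff: "q_int (int m - int i) = (q_poly (m - i) :: 'a upoly)" if "i \<le> m" for i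
    using that by (simp flip: of_nat_diff)
  have n_eq: "2 * (n div 2) = n - 1" using n(1) by (auto elim!: oddE)
  have "schur_Q (Delta m n) = pfaffian (Suc (n div 2)) ?C"
  proof (cases "n \<le> m")
    case True
    have C: "Q_pair (if i < n then m - i else 0) (if j < n then m - j else 0) = ?C i j"
      if "i < 2 * Suc (n div 2)" "j < 2 * Suc (n div 2)" for i j
    proof -
      have le: "i \<le> n" "j \<le> n" using that n_eq odd_pos[OF n(1)] by auto
      consider "i < n" "j < n" | "i < n" "j = n" | "i = n" "j < n" | "i = n" "j = n"
        using le by linarith
      then show ?thesis
      proof cases
        case 1
        then show ?thesis
          using True unfolding C_split by (simp add: C_inner[simplified]) (simp add: T1_def T2_def)
      next
        case 2
        then have "?C i j = q_int (int m - int i)"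
          using True unfolding C_split by (subst C_outer) (auto simp: T1_def T2_def)
        then show ?thesis
          using 2 True by (simp add: Q0 q_diff)
      next
        case 3
        then have "?C i j = - q_int (int m - int j)"
          using True unfolding C_split by (subst C_outer) (auto simp: T1_def T2_def)
        then show ?thesis
          using 3 True by (simp add: Q_pair_def Q_pair_gt_def q_diff)
      next
        case 4
        then show ?thesis
          unfolding C_split by (subst C_outer) (auto simp: T1_def T2_def Q_pair_def)
      qed
    qed
    have "schur_Q (Delta m n) = pfaffian (Suc (n div 2))
        (\<lambda>i j. Q_pair (if i < n then m - i else 0) (if j < n then m - j else 0) :: 'a upoly)"
      using n(1) True by (rule schur_Q_Delta_odd)
    also have "\<dots> = pfaffian (Suc (n div 2)) ?C"
      by (rule pfaffian_cong) (rule C)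
    finally show ?thesis .
  next
    case False
    then have nm: "n = Suc m" using n(2) by simp
    then have m: "even m" "2 * (m div 2) = m" using n(1) by auto
    have "schur_Q (Delta m n) = pfaffian (m div 2) (\<lambda>i j. Q_pair (m - i) (m - j) :: 'a upoly)"
      unfolding nm using m(1) by (rule schur_Q_Delta_Suc)
    also have "\<dots> = pfaffian (m div 2) ?C"
    proof (rule pfaffian_cong)
      fix i j assume "i < 2 * (m div 2)" "j < 2 * (m div 2)"
      then have "i < m" "j < m" by auto
      then show "Q_pair (m - i) (m - j) = ?C i j"
        unfolding C_split using nm by (subst C_inner) (auto simp: T1_def T2_def)
    qed
    also have "\<dots> = pfaffian (Suc (m div 2)) ?C"
    proof (rule pfaffian_last_pair[symmetric])
      have "?C m (m + 1) = 1"
        unfolding C_split using nm by (subst C_outer) (auto simp: T1_def T2_def)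
      then show "?C (2 * (m div 2)) (2 * (m div 2) + 1) = 1"
        by (simp only: m(2))
      fix i assume "i < 2 * (m div 2)"
      then have i: "i < m" using m(2) by simp
      then have "?C i m = - q_poly (m - i) + Q_pair (m - i) (m - m)"
        unfolding C_split using nm by (subst C_inner) (auto simp: T1_def T2_def q_diff)
      then have "?C i m = 0" using i by (simp add: Q0)
      then show "?C i (2 * (m div 2)) = 0" by (simp only: m(2))
    qed
    also have "m div 2 = n div 2" using nm m(1) by simp
    finally show ?thesis .
  qed
  also have "\<dots> = (\<Sum>B | B \<subseteq> {0..m} \<and> card B = Suc (n div 2). (\<Prod>e\<in>B. (- 1) ^ e) *
      det_of_rows (concat (map (\<lambda>e. [T1 e, T2 e]) (sorted_list_of_set B))))"
    by (rule pfaffian_minor_summation) simp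
  also have "\<dots> = (\<Sum>B\<in>{B. B \<subseteq> {0..m} \<and> card B = Suc (n div 2) \<and> 0 \<in> B}. (\<Prod>e\<in>B. (- 1) ^ e) *
      det_of_rows (concat (map (\<lambda>e. [T1 e, T2 e]) (sorted_list_of_set B))))"
  proof (rule sum.mono_neutral_right)
    show "\<forall>B\<in>{B. B \<subseteq> {0..m} \<and> card B = Suc (n div 2)} -
        {B. B \<subseteq> {0..m} \<and> card B = Suc (n div 2) \<and> 0 \<in> B}.
      (\<Prod>e\<in>B. (- 1) ^ e) * det_of_rows (concat (map (\<lambda>e. [T1 e, T2 e]) (sorted_list_of_set B))) = 0"
    proof
      fix B
      assume "B \<in> {B. B \<subseteq> {0..m} \<and> card B = Suc (n div 2)} -
        {B. B \<subseteq> {0..m} \<and> card B = Suc (n div 2) \<and> 0 \<in> B}"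
      then have B: "B \<subseteq> {0..m}" "card B = Suc (n div 2)" "0 \<notin> B" by auto
      have finB: "finite B" using B(1) finite_subset by blast
      have "length (concat (map (\<lambda>e. [T1 e, T2 e]) (sorted_list_of_set B))) = 2 * card B"
        by (simp add: length_concat comp_def sum_list_triv)
      then have "det_of_rows (concat (map (\<lambda>e. [T1 e, T2 e]) (sorted_list_of_set B))) = 0"
        using B finB n_eq by (intro det_of_rows_zero_column[of n]) (auto simp: T1_def T2_def intro!: gr0I)
      then show "(\<Prod>e\<in>B. (- 1) ^ e) *
          det_of_rows (concat (map (\<lambda>e. [T1 e, T2 e]) (sorted_list_of_set B))) = 0" by simp
    qed
  qed auto
  also have "\<dots> = (\<Sum>A | A \<subseteq> {1..m} \<and> card A = n div 2. (- 1) ^ (\<Sum>A + n div 2) *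
       det_of_rows (map (\<lambda>s j. q_int (int m + s - int j)) (symmetric_set_list A True)))"
  proof (rule sum.reindex_bij_witness[of _ "insert 0" "\<lambda>B. B - {0}"])
    fix B assume "B \<in> {B. B \<subseteq> {0..m} \<and> card B = Suc (n div 2) \<and> 0 \<in> B}"
    then have B: "B \<subseteq> {0..m}" "card B = Suc (n div 2)" "0 \<in> B" by auto
    have finB: "finite B" using B(1) finite_subset by blast
    define A where "A = B - {0}"
    have "A \<subseteq> {1..m}"
      using B(1) by (auto simp: A_def Suc_le_eq)
    moreover have "finite A" "0 \<notin> A"
      using finB by (simp_all add: A_def)
    moreover have "card A = n div 2"
      using B(2,3) by (simp add: A_def)
    moreover have "B = insert 0 A"
      using B(3) by (auto simp: A_def)
    ultimately have A: "A \<subseteq> {1..m}" "card A = n div 2" "finite A" "0 \<notin> A" "B = insert 0 A"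
      by blast+
    show "insert 0 (B - {0}) = B"
      using B(3) by auto
    show "B - {0} \<in> {A. A \<subseteq> {1..m} \<and> card A = n div 2}"
      using A(1,2) by (simp add: A_def)
    let ?as = "sorted_list_of_set A"
    let ?rs = "rev (map T1 ?as) @ [T1 0] @ map T2 ?as"
    have len: "length ?rs = n"
      using A n_eq n(1) by (auto elim!: oddE)
    have "sorted_list_of_set B = 0 # ?as"
      using A by (simp add: sorted_list_of_set_insert_remove insort_is_Cons)
    then have "det_of_rows (concat (map (\<lambda>e. [T1 e, T2 e]) (sorted_list_of_set B))) =
        det_of_rows (rev (map T1 (0 # ?as)) @ map T2 (0 # ?as))"
      using det_of_rows_unzip_pairs[of "[]" T1 T2 "0 # ?as" "[]"] by simp
    \<comment> \<open>The auxiliary row passes the \<open>card A\<close> rows with negative index; being the only row with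
      a nonzero last entry, it can then be split off.\<close>
    also have "\<dots> = (- 1) ^ card A * det_of_rows (?rs @ [T2 0])"
      using det_of_rows_move[of "rev (map T1 ?as) @ [T1 0]" "T2 0" "map T2 ?as" "[]"] by simp
    also have "det_of_rows (?rs @ [T2 0]) = det_of_rows ?rs"
    proof (rule det_of_rows_snoc)
      show "T2 0 (length ?rs) = 1" unfolding len by (simp add: T2_def)
      show "x (length ?rs) = 0" if "x \<in> set ?rs" for x
        using that A unfolding len by (auto simp: T1_def T2_def)
    qed
    also have "det_of_rows ?rs =
        det_of_rows (map (\<lambda>s j. q_int (int m + s - int j)) (symmetric_set_list A True))"
    proof -
      have "(?rs ! i) j = (map (\<lambda>s j. q_int (int m + s - int j)) (symmetric_set_list A True) ! i) j"
        if "i < n" "j < n" for i j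
      proof -
        have "length ?as = card A" by simp
        have pos: "?as ! k \<noteq> 0" if "k < card A" for k
          using that A nth_mem[of k ?as] by (metis \<open>length ?as = card A\<close> set_sorted_list_of_set)
        show ?thesis
          using that len A
          by (auto simp: symmetric_set_list_def nth_append rev_nth nth_Cons' T1_def T2_def pos algebra_simps)
      qed
      then show ?thesis
        unfolding det_of_rows_def using len A n_eq n(1)
        by (intro arg_cong[where f = det] eq_matI) (auto simp: length_symmetric_set_list)
    qed
    finally show "(- 1) ^ (\<Sum>(B - {0}) + n div 2) *
        det_of_rows (map (\<lambda>s j. q_int (int m + s - int j)) (symmetric_set_list (B - {0}) True)) =
      (\<Prod>e\<in>B. (- 1) ^ e) * det_of_rows (concat (map (\<lambda>e. [T1 e, T2 e]) (sorted_list_of_set B)))"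
      using A by (simp add: A_def[symmetric] power_sum power_add)
  next
    fix A assume "A \<in> {A. A \<subseteq> {1..m} \<and> card A = n div 2}"
    then have A: "A \<subseteq> {1..m}" "card A = n div 2" by auto
    then have "finite A" "0 \<notin> A" using finite_subset by auto
    then show "insert 0 A - {0} = A" "insert 0 A \<in> {B. B \<subseteq> {0..m} \<and> card B = Suc (n div 2) \<and> 0 \<in> B}"
      using A by auto
  qed
  finally show ?thesis .
qed

theorem theorem7p3:
  fixes m n :: nat and k :: "nat list \<Rightarrow> nat"
  assumes "int m - int n + 1 \<ge> 0"
    and "\<And>\<mu>. \<mu> \<in> I0 n m \<Longrightarrow> admissible (k \<mu>) \<mu>"
  shows "(schur_Q (Delta m n) :: 'a::field_char_0 upoly) =
    (- 1) ^ ((m + 1) * (m + 2 * n) div 2) *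
    (\<Sum>\<mu> | \<mu> \<in> I0 n m \<and> bar_quotient0 \<mu> = [].
       of_int (delta0 m \<mu>) * schur_S_odd (bar_quotient1 (k \<mu>) \<mu>))"
proof -
  let ?\<epsilon> = "(- 1) ^ ((m + 1) * (m + 2 * n) div 2)"
  let ?\<mu> = "\<lambda>A. extended_core m A (odd n)"
  let ?S = "{A. A \<subseteq> {1..m} \<and> card A = n div 2}"
  let ?t = "if odd n then n div 2 else 0"
  have n: "n \<le> m + 1" using assms(1) by linarith
  have "(schur_Q (Delta m n) :: 'a upoly) = (\<Sum>A\<in>?S. (- 1) ^ (\<Sum>A + ?t) *
       det_of_rows (map (\<lambda>s j. q_int (int m + s - int j)) (symmetric_set_list A (odd n))))"
    using schur_Q_Delta_eq_sum_even[OF _ n] schur_Q_Delta_eq_sum_odd[OF _ n] by (cases "odd n") simp_all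
  also have "\<dots> = (\<Sum>A\<in>?S. ?\<epsilon> * (of_int (delta0 m (?\<mu> A)) * schur_S_odd (bar_quotient1 (k (?\<mu> A)) (?\<mu> A))))"
  proof (rule sum.cong[OF refl])
    fix A assume "A \<in> ?S"
    then have A: "A \<subseteq> {1..m}" "card A = n div 2" by auto
    have "length (symmetric_set_list A (odd n)) = n"
      using A(2) by (simp add: length_symmetric_set_list)
    then have "det_of_rows (map (\<lambda>s j. q_int (int m + s - int j)) (symmetric_set_list A (odd n))) =
        (- 1) ^ (n choose 2) * (schur_S_odd (bar_quotient1 m (?\<mu> A)) :: 'a upoly)"
      unfolding bar_quotient1_extended_core[OF A] using n by (intro det_of_symmetric_rows)
    moreover have "schur_S_odd (bar_quotient1 m (?\<mu> A)) =
        (schur_S_odd (bar_quotient1 (k (?\<mu> A)) (?\<mu> A)) :: 'a upoly)"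
      using strict_partition_extended_core admissible_extended_core assms(2) extended_core_in_I0[OF A]
      by (intro schur_S_odd_bar_quotient1_eq) auto
    moreover have "?\<epsilon> * of_int (delta0 m (?\<mu> A)) =
        (of_int ((- 1) ^ (\<Sum>A + ?t + (n choose 2))) :: 'a upoly)"
      unfolding delta0_extended_core[OF A, symmetric] by simp
    ultimately show "(- 1) ^ (\<Sum>A + ?t) *
        det_of_rows (map (\<lambda>s j. q_int (int m + s - int j)) (symmetric_set_list A (odd n))) =
      ?\<epsilon> * (of_int (delta0 m (?\<mu> A)) * (schur_S_odd (bar_quotient1 (k (?\<mu> A)) (?\<mu> A)) :: 'a upoly))"
      by (simp add: mult.assoc[symmetric] power_add)
  qed
  also have "\<dots> = ?\<epsilon> * (\<Sum>A\<in>?S. of_int (delta0 m (?\<mu> A)) * schur_S_odd (bar_quotient1 (k (?\<mu> A)) (?\<mu> A)))"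
    by (simp only: sum_distrib_left)
  also have "(\<Sum>A\<in>?S. of_int (delta0 m (?\<mu> A)) * schur_S_odd (bar_quotient1 (k (?\<mu> A)) (?\<mu> A))) =
      (\<Sum>\<mu> | \<mu> \<in> I0 n m \<and> bar_quotient0 \<mu> = [].
        of_int (delta0 m \<mu>) * schur_S_odd (bar_quotient1 (k \<mu>) \<mu>) :: 'a upoly)"
  proof -
    have "inj_on ?\<mu> ?S"
      by (rule inj_on_subset[OF inj_on_extended_core]) auto
    then show ?thesis
      unfolding I0_bar_quotient0_Nil_eq by (subst sum.reindex) simp_all
  qed
  finally show ?thesis .
qed

end
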